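(* Let $T\subseteq\mathbb T^n$ be a torus acting on $\mathbb C^n$ with simple spectrum and let $v\in(\mathbb C^* )^n$. Suppose that $Y\subset T^{\mathbb C}v$ is a finite union of $T$-orbits (including $Tv$), and set $X=T^{\mathbb R}v\cap Y$. Then $X$ is finite and $$\widehat Y=\mathrm{clos}\big(T\exp(P_X)v\big)$$ $$=\mathrm{clos}\{z\in T^{\mathbb C}v:\ \nu_s(z)\le e^{c_s}\nu_s(v)\ \text{for all } s\in\mathfrak N_X\}$$ $$=\bigcup_{u\in\exp(Q_X)v}\widehat{Tu}$$ $$=T\exp(P_X)I_Tv,$$ where $Q_X,P_X,\mathfrak N_X,c_s,\nu_s,I_T$ are defined in the context.
   Context: The polynomial hull of a compact $Q\subset\mathbb C^n$ is $\widehat Q=\{z\in\mathbb C^n:|p(z)|\le\sup_Q|p|\text{ for all holomorphic polynomials }p\}$. $\mathbb T^n$ is the group of diagonal unitary matrices, identified with a subset of $\mathbb C^n$; products and $\exp$ in $\mathbb C^n$ are coordinatewise. $T\subseteq\mathbb T^n$ is a torus with Lie algebra $\mathfrak t\subseteq i\mathbb R^n$; $\mathfrak t^{\mathbb R}=i\mathfrak t\subseteq\mathbb R^n$, $T^{\mathbb R}=\exp(\mathfrak t^{\mathbb R})$, $T^{\mathbb C}=\exp(\mathfrak t+\mathfrak t^{\mathbb R})\subseteq(\mathbb C^* )^n$. Simple spectrum: the $n$ characters of $T$ on the coordinate lines are pairwise distinct. $\mathbb R^n_+$ is the set of vectors with positive entries. $C_T=\mathfrak t^{\mathbb R}\cap\mathrm{clos}(-\mathbb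 R^n_+)$ and $I_T=\{\lim_{t\to+\infty}\exp(t\xi):\xi\in C_T\}$ (a finite set of $0/1$-vectors). For $v\in(\mathbb C^* )^n$ the map $x\mapsto\exp(x)v$, $\mathfrak t^{\mathbb R}\to T^{\mathbb R}v$, is a bijection; its inverse is $\log_v$. For a finite $X\subset T^{\mathbb R}v$: $Q_X=\mathrm{conv}(\log_vX)$, $P_X=Q_X+C_T$ (a convex polyhedron), and $\mathfrak N_X\subset\mathbb R^n$ is a finite set with real numbers $c_s$ ($s\in\mathfrak N_X$) such that $P_X=\{x\in\mathfrak t^{\mathbb R}:\langle x,s\rangle\le c_s\text{ for all }s\in\mathfrak N_X\}$. For $s\in\mathbb R^n$, $z\in(\mathbb C^* )^n$: $\nu_s(z)=\prod_{k=1}^n|z_k|^{s_k}$. *)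

theory Defs
  imports "HOL-Analysis.Analysis"
begin

text \<open>
  \<open>\<complex>\<^sup>n\<close> is \<^typ>\<open>complex^'n\<close>, whose multiplication is coordinatewise; products of sets such as
  \<open>T * {u}\<close> are Minkowski products.
\<close>

definition polynomial_fun :: "(complex^'n \<Rightarrow> complex) \<Rightarrow> bool" where
  "polynomial_fun p \<longleftrightarrow>
     (\<exists>(A :: ('n \<Rightarrow> nat) set) c. finite A \<and>
        (\<forall>z. p z = (\<Sum>\<alpha>\<in>A. c \<alpha> * (\<Prod>k\<in>UNIV. (z $ k) ^ \<alpha> k))))"

text \<open>Meaningful for nonempty compact \<open>Q\<close>, where the supremum is that of a bounded nonempty set.\<close>

definition polynomial_hull :: "(complex^'n) set \<Rightarrow> (complex^'n) set" where
  "polynomial_hull Q =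
     {z. \<forall>p. polynomial_fun p \<longrightarrow> cmod (p z) \<le> (SUP w\<in>Q. cmod (p w))}"

definition vexp :: "complex^'n \<Rightarrow> complex^'n" where
  "vexp z = (\<chi> k. exp (z $ k))"

definition cvec :: "real^'n \<Rightarrow> complex^'n" where
  "cvec x = (\<chi> k. complex_of_real (x $ k))"

definition rexp :: "real^'n \<Rightarrow> complex^'n" where
  "rexp x = vexp (cvec x)"

definition unit_torus :: "(complex^'n) set" where
  "unit_torus = {t. \<forall>k. cmod (t $ k) = 1}"

text \<open>A diagonal unitary matrix is identified with the vector of its diagonal entries. The subtori
  of the group of these are its closed connected subgroups.\<close>

definition is_torus :: "(complex^'n) set \<Rightarrow> bool" where
  "is_torus T \<longleftrightarrow>
     T \<subseteq> unit_torus \<and> 1 \<in> T \<and> (\<forall>s\<in>T. \<forall>t\<in>T. s * t \<in> T) \<and>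
     (\<forall>t\<in>T. (\<chi> k. inverse (t $ k)) \<in> T) \<and> closed T \<and> connected T"

definition simple_spectrum :: "(complex^'n) set \<Rightarrow> bool" where
  "simple_spectrum T \<longleftrightarrow> (\<forall>j k. j \<noteq> k \<longrightarrow> (\<exists>t\<in>T. t $ j \<noteq> t $ k))"

definition lie_alg :: "(complex^'n) set \<Rightarrow> (complex^'n) set" where
  "lie_alg T = {\<xi>. (\<forall>k. Re (\<xi> $ k) = 0) \<and> (\<forall>r::real. vexp (r *\<^sub>R \<xi>) \<in> T)}"

text \<open>\<open>\<i>\<tt>\<close>, regarded as a subset of \<open>\<real>\<^sup>n\<close>.\<close>

definition real_lie_alg :: "(complex^'n) set \<Rightarrow> (real^'n) set" where
  "real_lie_alg T = {x. \<exists>\<xi>\<in>lie_alg T. cvec x = (\<chi> k. \<i> * \<xi> $ k)}"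

definition real_torus :: "(complex^'n) set \<Rightarrow> (complex^'n) set" where
  "real_torus T = rexp ` real_lie_alg T"

definition complex_torus :: "(complex^'n) set \<Rightarrow> (complex^'n) set" where
  "complex_torus T = vexp ` (lie_alg T + cvec ` real_lie_alg T)"

definition C_cone :: "(complex^'n) set \<Rightarrow> (real^'n) set" where
  "C_cone T = real_lie_alg T \<inter> closure (uminus ` {x. \<forall>k. 0 < x $ k})"

definition I_set :: "(complex^'n) set \<Rightarrow> (complex^'n) set" where
  "I_set T = {l. \<exists>\<xi>\<in>C_cone T. ((\<lambda>r::real. rexp (r *\<^sub>R \<xi>)) \<longlongrightarrow> l) at_top}"

definition log_at :: "(complex^'n) set \<Rightarrow> complex^'n \<Rightarrow> complex^'n \<Rightarrow> real^'n" where
  "log_at T v = inv_into (real_lie_alg T) (\<lambda>x. rexp x * v)"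

definition Q_set :: "(complex^'n) set \<Rightarrow> complex^'n \<Rightarrow> (complex^'n) set \<Rightarrow> (real^'n) set" where
  "Q_set T v X = convex hull (log_at T v ` X)"

definition P_set :: "(complex^'n) set \<Rightarrow> complex^'n \<Rightarrow> (complex^'n) set \<Rightarrow> (real^'n) set" where
  "P_set T v X = Q_set T v X + C_cone T"

definition nu :: "real^'n \<Rightarrow> complex^'n \<Rightarrow> real" where
  "nu s z = (\<Prod>k\<in>UNIV. cmod (z $ k) powr (s $ k))"

end

theory Submission
  imports
    Defs
    "HOL-Analysis.Kronecker_Approximation_Theorem"
    "HOL-Complex_Analysis.Conformal_Mappings"
begin

text \<open>
  Write \<open>V\<close> for \<open>real_lie_alg T\<close> and \<open>Y = T exp(F) v\<close> with \<open>F \<subseteq> V\<close> finite. For a polynomial \<open>p\<close>, the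
  maximum principle on strips shows that \<open>{x \<in> V. \<bar>p\<bar> \<le> B on T exp(x) v}\<close> is convex, and on half-planes
  that it is stable under adding the cone \<open>C\<^sub>T\<close>, along which \<open>p\<close> stays bounded. Hence
  \<open>T exp(P) v\<close> lies in the hull.

  Conversely, let \<open>z\<close> be in the hull and \<open>S\<close> its support. Since \<open>V\<close> is a rational subspace, its annihilator
  is approximated by integer vectors, each of which gives a binomial vanishing on \<open>Y\<close>, hence at \<open>z\<close>. These
  binomials yield a \<open>\<xi> \<in> C\<^sub>T\<close> with zero set \<open>S\<close>, an \<open>x \<in> V\<close> with the moduli of \<open>z / v\<close> on \<open>S\<close>, and, by duality
  for closed subgroups of the compact torus, a \<open>t \<in> T\<close> with the phases of \<open>z / v\<close> on \<open>S\<close>. If no point of the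
  convex hull of \<open>F\<close> dominated \<open>x\<close> on \<open>S\<close>, a separating functional, rounded to a monomial, would violate
  \<open>z\<close> being in the hull. Therefore \<open>x\<close> can be corrected by a multiple of \<open>\<xi>\<close> to a point of \<open>P\<close>.
\<close>

section \<open>The Lie algebra of a subtorus\<close>

text \<open>Parametrises \<open>unit_torus\<close> by real vectors, so that the Lie algebra can be
  handled inside \<open>real^'n\<close>.\<close>

definition iexp :: "real^'n \<Rightarrow> complex^'n" where
  "iexp x = (\<chi> k. cis (x $ k))"

lemma iexp_component [simp]: "iexp x $ k = cis (x $ k)"
  by (simp add: iexp_def)

lemma rexp_component [simp]: "rexp x $ k = of_real (exp (x $ k))"
  by (simp add: rexp_def vexp_def cvec_def exp_of_real)

lemma iexp_0 [simp]: "iexp 0 = 1"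
  by (simp add: vec_eq_iff)

lemma iexp_add: "iexp (x + y) = iexp x * iexp y"
  by (simp add: vec_eq_iff cis_mult)

lemma rexp_0 [simp]: "rexp 0 = 1"
  by (simp add: vec_eq_iff)

lemma rexp_add: "rexp (x + y) = rexp x * rexp y"
  by (simp add: vec_eq_iff exp_add)

lemma continuous_on_iexp: "continuous_on S iexp"
  unfolding iexp_def by (intro continuous_intros)

lemma continuous_on_vec_mult [continuous_intros]:
  fixes f g :: "'a::topological_space \<Rightarrow> ('b::real_normed_algebra)^'n"
  assumes "continuous_on S f" "continuous_on S g"
  shows "continuous_on S (\<lambda>x. f x * g x)"
proof -
  have "(\<lambda>x. f x * g x) = (\<lambda>x. \<chi> k. f x $ k * g x $ k)"
    by (simp add: vec_eq_iff fun_eq_iff)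
  moreover have "continuous_on S (\<lambda>x. \<chi> k. f x $ k * g x $ k)"
    using assms by (intro continuous_intros)
  ultimately show ?thesis by (simp only:)
qed

lemma lie_alg_iff:
  "\<xi> \<in> lie_alg T \<longleftrightarrow> (\<exists>x. \<xi> = (\<chi> k. \<i> * of_real (x $ k)) \<and> (\<forall>r. iexp (r *\<^sub>R x) \<in> T))"
proof -
  have eq: "vexp (r *\<^sub>R (\<chi> k. \<i> * of_real (x $ k))) = iexp (r *\<^sub>R x)" for r x
    unfolding vexp_def iexp_def vec_eq_iff vector_scaleR_component vec_lambda_beta cis_conv_exp
    by (simp add: scaleR_conv_of_real mult_ac)
  show ?thesis
  proof
    assume \<xi>: "\<xi> \<in> lie_alg T"
    define x where "x = (\<chi> k. Im (\<xi> $ k))"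
    have x: "\<xi> = (\<chi> k. \<i> * of_real (x $ k))"
      using \<xi> by (simp add: lie_alg_def x_def vec_eq_iff complex_eq_iff)
    have "\<forall>r. vexp (r *\<^sub>R \<xi>) \<in> T"
      using \<xi> by (simp add: lie_alg_def)
    then have "\<forall>r. iexp (r *\<^sub>R x) \<in> T"
      unfolding x eq .
    with x show "\<exists>x. \<xi> = (\<chi> k. \<i> * of_real (x $ k)) \<and> (\<forall>r. iexp (r *\<^sub>R x) \<in> T)"
      by blast
  next
    assume "\<exists>x. \<xi> = (\<chi> k. \<i> * of_real (x $ k)) \<and> (\<forall>r. iexp (r *\<^sub>R x) \<in> T)"
    then obtain x where x: "\<xi> = (\<chi> k. \<i> * of_real (x $ k))" "\<forall>r. iexp (r *\<^sub>R x) \<in> T"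
      by blast
    show "\<xi> \<in> lie_alg T"
      unfolding lie_alg_def x(1) mem_Collect_eq eq using x(2) by simp
  qed
qed

text \<open>An element \<open>\<i> y\<close> of the Lie algebra corresponds to \<open>- y\<close>;
  the sign is absorbed because \<open>r\<close> runs over all reals.\<close>

lemma real_lie_alg_iff: "x \<in> real_lie_alg T \<longleftrightarrow> (\<forall>r. iexp (r *\<^sub>R x) \<in> T)"
proof
  assume "x \<in> real_lie_alg T"
  then obtain \<xi> y where \<xi>: "cvec x = (\<chi> k. \<i> * \<xi> $ k)" "\<xi> = (\<chi> k. \<i> * of_real (y $ k))"
    and y2: "\<forall>r. iexp (r *\<^sub>R y) \<in> T"
    unfolding real_lie_alg_def Bex_def lie_alg_iff by blast
  have "complex_of_real (x $ k) = of_real (- y $ k)" for k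
    using \<xi> by (simp add: cvec_def vec_eq_iff)
  then have "x = - y"
    by (simp only: of_real_eq_iff) (simp add: vec_eq_iff)
  then have "iexp (r *\<^sub>R x) = iexp ((-r) *\<^sub>R y)" for r
    by simp
  then show "\<forall>r. iexp (r *\<^sub>R x) \<in> T"
    using y2 by metis
next
  assume *: "\<forall>r. iexp (r *\<^sub>R x) \<in> T"
  have "iexp (r *\<^sub>R (- x)) = iexp ((- r) *\<^sub>R x)" for r
    by simp
  then have "(\<chi> k. \<i> * of_real ((- x) $ k)) \<in> lie_alg T"
    unfolding lie_alg_iff using * by metis
  moreover have "cvec x = (\<chi> k. \<i> * (\<chi> k. \<i> * of_real ((- x) $ k)) $ k)"
    by (simp add: cvec_def vec_eq_iff)
  ultimately show "x \<in> real_lie_alg T"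
    unfolding real_lie_alg_def by blast
qed

lemma subspace_real_lie_alg:
  assumes "is_torus T"
  shows "subspace (real_lie_alg T)"
proof -
  have T: "1 \<in> T" "\<And>s t. s \<in> T \<Longrightarrow> t \<in> T \<Longrightarrow> s * t \<in> T"
    using assms by (auto simp: is_torus_def)
  show ?thesis
    unfolding subspace_def
    by (intro conjI ballI allI; simp only: real_lie_alg_iff scaleR_add_right iexp_add scaleR_scaleR)
       (simp_all add: T)
qed


text \<open>The argument of Cartan's closed subgroup theorem: the components orthogonal to \<open>real_lie_alg T\<close> of
  a sequence of counterexamples tending to 0 would have a limit direction in \<open>real_lie_alg T\<close>.\<close>

lemma real_lie_alg_if_small:
  fixes T :: "(complex^'n) set"
  assumes T: "is_torus T"
  obtains \<delta> where "\<delta> > 0" "\<And>y. norm y < \<delta> \<Longrightarrow> iexp y \<in> T \<Longrightarrow> y \<in> real_lie_alg T"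
proof -
  let ?V = "real_lie_alg T"
  have V: "subspace ?V" by (rule subspace_real_lie_alg[OF T])
  have Tm: "1 \<in> T" "\<And>s t. s \<in> T \<Longrightarrow> t \<in> T \<Longrightarrow> s * t \<in> T" "closed T"
    using T by (auto simp: is_torus_def)
  have VT: "iexp a \<in> T" if "a \<in> ?V" for a
    using that unfolding real_lie_alg_iff by (metis scaleR_one)
  have "\<exists>\<delta>>0. \<forall>y. norm y < \<delta> \<longrightarrow> iexp y \<in> T \<longrightarrow> y \<in> ?V"
  proof (rule ccontr)
    assume neg: "\<not> ?thesis"
    have "\<exists>b. norm b < inverse (real (Suc n)) \<and> iexp b \<in> T \<and> b \<noteq> 0 \<and> (\<forall>w\<in>?V. orthogonal b w)" for n
    proof -
      obtain y where y: "norm y < inverse (real (Suc n))" "iexp y \<in> T" "y \<notin> ?V"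
        using neg by (metis inverse_positive_iff_positive of_nat_0_less_iff zero_less_Suc)
      obtain a b where ab: "a \<in> span ?V" "\<And>w. w \<in> span ?V \<Longrightarrow> orthogonal b w" "y = a + b"
        using orthogonal_subspace_decomp_exists by blast
      have a: "a \<in> ?V" using ab(1) V by (simp add: span_eq_iff[THEN iffD2])
      \<comment> \<open>The component \<open>a\<close> exponentiates into \<open>T\<close> and can
        be divided out, so \<open>b\<close> inherits the membership \<open>iexp b \<in> T\<close>
        from \<open>y\<close>.\<close>
      have "b = - a + y" by (simp add: ab(3))
      then have "iexp b \<in> T"
        using VT[of "- a"] V a y(2) Tm(2) by (simp add: iexp_add subspace_neg del: add_uminus_conv_diff uminus_add_conv_diff)
      moreover have "b \<noteq> 0" using y(3) ab(3) a by auto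
      moreover have "norm b \<le> norm y"
      proof -
        have "orthogonal a b" using ab(1,2) by (simp add: orthogonal_commute)
        then have "(norm y)\<^sup>2 = (norm a)\<^sup>2 + (norm b)\<^sup>2"
          unfolding ab(3) by (rule norm_add_Pythagorean)
        then have "(norm b)\<^sup>2 \<le> (norm y)\<^sup>2" by simp
        then show ?thesis by (rule power2_le_imp_le) simp
      qed
      ultimately show ?thesis
        using y(1) ab(2) by (metis le_less_trans span_base)
    qed
    then obtain b where b: "\<And>n. norm (b n) < inverse (real (Suc n))" "\<And>n. iexp (b n) \<in> T"
        "\<And>n. b n \<noteq> 0" "\<And>n w. w \<in> ?V \<Longrightarrow> orthogonal (b n) w"
      by metis
    define c where "c n = b n /\<^sub>R norm (b n)" for n
    have "compact (sphere (0::real^'n) 1)" by simp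
    moreover have "c n \<in> sphere 0 1" for n using b(3) by (simp add: c_def)
    ultimately obtain l r where l: "l \<in> sphere 0 1" "strict_mono r" "(c \<circ> r) \<longlonglongrightarrow> l"
      unfolding compact_def by metis
    have iter: "iexp (real j *\<^sub>R b n) \<in> T" for j n
      by (induction j) (auto simp: Tm b(2) scaleR_add_left iexp_add)
    have b0: "(\<lambda>n. norm (b n)) \<longlonglongrightarrow> 0"
    proof (rule tendsto_sandwich[OF _ _ tendsto_const LIMSEQ_inverse_real_of_nat])
      show "\<forall>\<^sub>F n in sequentially. norm (b n) \<le> inverse (real (Suc n))"
        by (intro always_eventually allI less_imp_le b(1))
    qed auto
    have pos: "iexp (s *\<^sub>R l) \<in> T" if "s \<ge> 0" for s
    proof -
      \<comment> \<open>Taking \<open>j n\<close> copies of \<open>b n\<close> covers the length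
        \<open>s\<close> up to an error of at most \<open>norm (b n)\<close>, which tends to 0.
        Along \<open>r\<close> the directions converge, so these multiples tend to
        \<open>s *\<^sub>R l\<close>, and \<open>T\<close> is closed.\<close>
      define j where "j n = nat \<lfloor>s / norm (b n)\<rfloor>" for n
      have j: "\<bar>real (j n) * norm (b n) - s\<bar> \<le> norm (b n)" for n
      proof -
        have p: "norm (b n) > 0" using b(3) by simp
        have "real (j n) \<le> s / norm (b n)" "s / norm (b n) \<le> real (j n) + 1"
          using that p unfolding j_def by (auto simp: zero_le_floor of_nat_nat; linarith)+
        then show ?thesis using p by (simp add: field_simps abs_le_iff)
      qed
      have "(\<lambda>n. real (j n) * norm (b n) - s) \<longlonglongrightarrow> 0"
        by (rule Lim_null_comparison[OF _ b0]) (use j in auto)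
      then have "(\<lambda>n. real (j n) * norm (b n)) \<longlonglongrightarrow> s"
        by (simp add: LIM_zero_iff)
      then have "(\<lambda>n. real (j (r n)) * norm (b (r n))) \<longlonglongrightarrow> s"
        using LIMSEQ_subseq_LIMSEQ[OF _ l(2)] by (fastforce simp: o_def)
      then have "(\<lambda>n. (real (j (r n)) * norm (b (r n))) *\<^sub>R c (r n)) \<longlonglongrightarrow> s *\<^sub>R l"
        using l(3) by (intro tendsto_scaleR) (auto simp: o_def)
      moreover have "(real (j n) * norm (b n)) *\<^sub>R c n = real (j n) *\<^sub>R b n" for n
        using b(3) by (simp add: c_def)
      ultimately have "(\<lambda>n. real (j (r n)) *\<^sub>R b (r n)) \<longlonglongrightarrow> s *\<^sub>R l" by simp
      then have "(\<lambda>n. iexp (real (j (r n)) *\<^sub>R b (r n))) \<longlonglongrightarrow> iexp (s *\<^sub>R l)"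
        using continuous_on_iexp[of UNIV] by (intro continuous_on_tendsto_compose[of UNIV iexp]) auto
      then show ?thesis
        by (rule Lim_in_closed_set[OF Tm(3), rotated 2]) (auto simp: iter)
    qed
    have "iexp (s *\<^sub>R l) \<in> T" for s
    proof (cases "s \<ge> 0")
      case False
      have "iexp ((- s) *\<^sub>R l) \<in> T" using pos[of "- s"] False by simp
      then have "(\<chi> k. inverse (iexp ((- s) *\<^sub>R l) $ k)) \<in> T"
        using T by (auto simp: is_torus_def)
      moreover have "(\<chi> k. inverse (iexp ((- s) *\<^sub>R l) $ k)) = iexp (s *\<^sub>R l)"
        by (simp add: vec_eq_iff)
      ultimately show ?thesis by simp
    qed (rule pos)
    then have lV: "l \<in> ?V" by (simp add: real_lie_alg_iff)
    \<comment> \<open>All directions \<open>c n\<close> are orthogonal to \<open>?V\<close>, which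
      now contains their limit \<open>l\<close>; hence \<open>l\<close> is orthogonal to itself
      although its norm is 1.\<close>
    have "(\<lambda>n. inner ((c \<circ> r) n) l) \<longlonglongrightarrow> inner l l"
      by (intro tendsto_inner l(3) tendsto_const)
    moreover have "inner ((c \<circ> r) n) l = 0" for n
      using b(4)[OF lV, of "r n"] by (simp add: c_def orthogonal_def)
    ultimately have "inner l l = 0" by (simp add: LIMSEQ_const_iff)
    then show False using l(1) by auto
  qed
  then show ?thesis using that by blast
qed

section \<open>Integer approximation and rationality of the Lie algebra\<close>

definition ivec :: "('n \<Rightarrow> int) \<Rightarrow> real^'n" where
  "ivec m = (\<chi> k. of_int (m k))"

lemma ivec_component [simp]: "ivec m $ k = of_int (m k)"
  by (simp add: ivec_def)

lemma inner_vec_real: "inner x y = (\<Sum>k\<in>UNIV. x $ k * y $ k)" for x y :: "real^'n"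
  by (simp add: inner_vec_def)

text \<open>Simultaneous Dirichlet approximation, transported along a numbering of the coordinates.
  The error of \<open>q *\<^sub>R x\<close> is bounded absolutely, not relative to \<open>q\<close>,
  which is what the integrality arguments require.\<close>

lemma Dirichlet_approx_vec:
  fixes x :: "real^'n"
  assumes "\<epsilon> > 0"
  obtains q :: int and m where "0 < q" "\<And>k. \<bar>(of_int q *\<^sub>R x - ivec m) $ k\<bar> < \<epsilon>"
proof -
  obtain h :: "'n \<Rightarrow> nat" where h: "bij_betw h UNIV {0..<CARD('n)}"
    using ex_bij_betw_finite_nat[of "UNIV :: 'n set"] by auto
  obtain N :: nat where N: "N > 0" "inverse (real N) < \<epsilon>"
    using ex_inverse_of_nat_less[OF assms] by auto
  obtain q p where q: "0 < q"
    and p: "\<And>i. i < CARD('n) \<Longrightarrow> \<bar>of_int q * (x $ inv h i) - of_int (p i)\<bar> < 1 / N"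
    using Dirichlet_approx_simult[OF N(1), where \<theta> = "\<lambda>i. x $ inv h i" and n = "CARD('n)"] by blast
  have "\<bar>(of_int q *\<^sub>R x - ivec (p \<circ> h)) $ k\<bar> < \<epsilon>" for k
  proof -
    have "h k < CARD('n)" "inv h (h k) = k"
      using h by (auto simp: bij_betw_def)
    then show ?thesis
      using p[of "h k"] N(2) by (simp add: inverse_eq_divide)
  qed
  with q show ?thesis using that by blast
qed

lemma iexp_add_ivec: "iexp (x + (2 * pi) *\<^sub>R ivec m) = iexp x"
proof -
  have "cis (2 * pi * of_int j) = 1" for j :: int
    by (simp add: complex_eq_iff cos_int_2pin sin_int_2pin)
  then show ?thesis
    by (simp add: vec_eq_iff flip: cis_mult)
qed

text \<open>The Dirichlet approximants \<open>m\<close> of a vector \<open>x\<close> in the Lie algebra satisfy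
  \<open>exp (2 \<pi> \<i> (q x - m)) \<in> T\<close> with \<open>q x - m\<close> small, so they lie in the Lie algebra, too.\<close>

lemma real_lie_alg_rational:
  fixes T :: "(complex^'n) set"
  assumes T: "is_torus T"
  shows "real_lie_alg T \<subseteq> span (real_lie_alg T \<inter> range ivec)"
proof (rule ccontr)
  let ?V = "real_lie_alg T" and ?W = "span (real_lie_alg T \<inter> range ivec)"
  assume "\<not> ?V \<subseteq> ?W"
  then obtain y where y: "y \<in> ?V" "y \<notin> ?W" by blast
  have V: "subspace ?V" by (rule subspace_real_lie_alg[OF T])
  have WV: "?W \<subseteq> ?V" by (rule span_minimal[OF _ V]) auto
  \<comment> \<open>The orthogonal part \<open>x\<close> is a nonzero vector of the Lie algebra
    perpendicular to all its integer vectors; this is what gets refuted.\<close>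
  obtain a x where ax: "a \<in> ?W" "\<And>w. w \<in> ?W \<Longrightarrow> orthogonal x w" "y = a + x"
    using orthogonal_subspace_decomp_exists[of "?V \<inter> range ivec" y] by blast
  have x0: "x \<noteq> 0" using ax y by auto
  have "y - a \<in> ?V" using y(1) ax(1) WV by (intro subspace_diff[OF V]) auto
  then have xV: "x \<in> ?V" by (simp add: ax(3))
  obtain \<delta> where \<delta>: "\<delta> > 0" "\<And>y. norm y < \<delta> \<Longrightarrow> iexp y \<in> T \<Longrightarrow> y \<in> ?V"
    using real_lie_alg_if_small[OF T] by blast
  \<comment> \<open>The coordinate errors have to add up to less than
    \<open>\<delta> / (2 * pi)\<close>, so that the choice of \<open>\<delta>\<close> applies to
    \<open>(2 * pi) *\<^sub>R d\<close>, and to less than \<open>norm x\<close>, so that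
    \<open>inner x d\<close> stays below \<open>(norm x)\<^sup>2\<close>.\<close>
  define \<epsilon> where "\<epsilon> = min (\<delta> / (2 * pi)) (norm x) / real CARD('n)"
  have \<epsilon>: "\<epsilon> > 0" using \<delta>(1) x0 by (simp add: \<epsilon>_def)
  obtain q m where q: "0 < q" and m: "\<And>k. \<bar>(of_int q *\<^sub>R x - ivec m) $ k\<bar> < \<epsilon>"
    using Dirichlet_approx_vec[OF \<epsilon>] by blast
  define d where "d = of_int q *\<^sub>R x - ivec m"
  have "norm d \<le> (\<Sum>k\<in>UNIV. \<bar>d $ k\<bar>)" by (rule norm_le_l1_cart)
  also have "\<dots> < (\<Sum>k\<in>(UNIV::'n set). \<epsilon>)"
    by (rule sum_strict_mono) (use m in \<open>auto simp: d_def\<close>)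
  finally have d: "norm d < \<delta> / (2 * pi)" "norm d < norm x" by (auto simp: \<epsilon>_def)
  have "iexp ((2 * pi) *\<^sub>R d) = iexp ((2 * pi * of_int q) *\<^sub>R x)"
    using iexp_add_ivec[of "(2 * pi) *\<^sub>R d" m] by (simp add: d_def scaleR_diff_right)
  also have "\<dots> \<in> T"
    using xV by (auto simp: real_lie_alg_iff)
  finally have "(2 * pi) *\<^sub>R d \<in> ?V"
    using d(1) by (intro \<delta>(2)) (auto simp: field_simps)
  then have "(1 / (2 * pi)) *\<^sub>R ((2 * pi) *\<^sub>R d) \<in> ?V" by (rule subspace_scale[OF V])
  then have "d \<in> ?V" by simp
  then have "of_int q *\<^sub>R x - d \<in> ?V"
    using V xV by (intro subspace_diff subspace_scale)
  then have "ivec m \<in> ?W" by (intro span_base) (auto simp: d_def)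
  then have "inner x (ivec m) = 0" using ax(2) by (auto simp: orthogonal_def)
  then have "of_int q * (norm x)\<^sup>2 = inner x d"
    by (simp add: d_def inner_diff_right power2_norm_eq_inner)
  also have "\<dots> \<le> norm x * norm d" by (rule norm_cauchy_schwarz)
  also have "\<dots> < norm x * norm x" using d(2) x0 by simp
  finally have "of_int q * (norm x)\<^sup>2 < 1 * (norm x)\<^sup>2" by (simp add: power2_eq_square)
  then have "real_of_int q < 1" using x0 by (simp only: mult_less_cancel_right) auto
  then show False using q by linarith
qed

text \<open>The Lie algebra is spanned by finitely many integer vectors. Against each of them an
  integer vector close enough to \<open>q *\<^sub>R \<eta>\<close> has an integer inner product of
  modulus below 1, which must be 0.\<close>

lemma real_lie_alg_annihilator_approx:
  fixes T :: "(complex^'n) set"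
  assumes T: "is_torus T" and \<eta>: "\<And>x. x \<in> real_lie_alg T \<Longrightarrow> inner \<eta> x = 0" and \<epsilon>: "\<epsilon> > 0"
  obtains q :: int and m where "0 < q" "\<And>x. x \<in> real_lie_alg T \<Longrightarrow> inner (ivec m) x = 0"
    "\<And>k. \<bar>(of_int q *\<^sub>R \<eta> - ivec m) $ k\<bar> < \<epsilon>"
proof -
  let ?V = "real_lie_alg T"
  obtain B where B: "B \<subseteq> ?V \<inter> range ivec" "independent B" "?V \<inter> range ivec \<subseteq> span B"
    by (rule maximal_independent_subset)
  have fin: "finite B" using B(2) by (rule finiteI_independent)
  \<comment> \<open>A common bound for the l1-norms of the spanning vectors; with
    \<open>\<epsilon>' * c < 1\<close> the approximation error in each inner product is below
    1.\<close>
  define c where "c = (\<Sum>b\<in>B. \<Sum>k\<in>UNIV. \<bar>b $ k\<bar>)"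
  have c: "(\<Sum>k\<in>UNIV. \<bar>b $ k\<bar>) \<le> c" if "b \<in> B" for b
    unfolding c_def using fin that by (intro member_le_sum) (auto intro: sum_nonneg)
  have c0: "c \<ge> 0" unfolding c_def by (intro sum_nonneg) auto
  define \<epsilon>' where "\<epsilon>' = min \<epsilon> (1 / (1 + c))"
  have \<epsilon>': "\<epsilon>' > 0" "\<epsilon>' * c < 1" using \<epsilon> c0
    by (auto simp: \<epsilon>'_def min_def field_simps)
  obtain q m where q: "0 < q" and m: "\<And>k. \<bar>(of_int q *\<^sub>R \<eta> - ivec m) $ k\<bar> < \<epsilon>'"
    using Dirichlet_approx_vec[OF \<epsilon>'(1)] by blast
  have "inner (ivec m) b = 0" if b: "b \<in> B" for b
  proof -
    obtain j where j: "b = ivec j" and bV: "b \<in> ?V" using B(1) b by blast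
    have "inner (ivec m) b = - inner (of_int q *\<^sub>R \<eta> - ivec m) b"
      using \<eta>[OF bV] by (simp add: inner_diff_left)
    then have "\<bar>inner (ivec m) b\<bar> \<le> (\<Sum>k\<in>UNIV. \<bar>(of_int q *\<^sub>R \<eta> - ivec m) $ k * b $ k\<bar>)"
      unfolding inner_vec_real by (simp only: abs_minus_cancel sum_abs)
    also have "\<dots> \<le> (\<Sum>k\<in>UNIV. \<epsilon>' * \<bar>b $ k\<bar>)"
      unfolding abs_mult by (intro sum_mono mult_right_mono less_imp_le[OF m]) auto
    also have "\<dots> \<le> \<epsilon>' * c"
      using c[OF b] \<epsilon>'(1) by (simp flip: sum_distrib_left)
    finally have "\<bar>inner (ivec m) b\<bar> < 1" using \<epsilon>'(2) by simp
    moreover have "inner (ivec m) b = of_int (\<Sum>k\<in>UNIV. m k * j k)"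
      by (simp add: inner_vec_real j)
    ultimately show ?thesis by (metis of_int_0 of_int_abs of_int_less_1_iff zabs_less_one_iff)
  qed
  then have "span B \<subseteq> {x. inner (ivec m) x = 0}"
    by (intro span_minimal subspace_hyperplane) auto
  moreover have "?V \<subseteq> span B"
    using real_lie_alg_rational[OF T] B(3) by (meson span_minimal subspace_span subset_trans)
  ultimately have "\<And>x. x \<in> ?V \<Longrightarrow> inner (ivec m) x = 0" by blast
  moreover have "\<bar>(of_int q *\<^sub>R \<eta> - ivec m) $ k\<bar> < \<epsilon>" for k
    using m[of k] unfolding \<epsilon>'_def by linarith
  ultimately show ?thesis using that q by blast
qed

section \<open>Duality for closed subgroups of the compact torus\<close>

definition character :: "('n \<Rightarrow> int) \<Rightarrow> complex^'n \<Rightarrow> complex" where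
  "character m z = (\<Prod>k\<in>UNIV. z $ k powi m k)"

lemma unit_torus_nonzero: "z \<in> unit_torus \<Longrightarrow> z $ k \<noteq> 0"
  by (metis (mono_tags, lifting) unit_torus_def mem_Collect_eq norm_zero zero_neq_one)

lemma character_mult: "character m (z * w) = character m z * character m w"
  by (simp add: character_def power_int_mult_distrib prod.distrib)

lemma character_1 [simp]: "character m 1 = 1"
  by (simp add: character_def)

lemma character_0 [simp]: "character (\<lambda>_. 0) z = 1"
  by (simp add: character_def)

lemma character_power: "character m (z ^ j) = character m z ^ j"
  by (induction j) (simp_all add: character_mult)

lemma character_add:
  "z \<in> unit_torus \<Longrightarrow> character (\<lambda>k. m k + n k) z = character m z * character n z"
  by (simp add: character_def power_int_add unit_torus_nonzero prod.distrib)

lemma norm_character: "z \<in> unit_torus \<Longrightarrow> cmod (character m z) = 1"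
  by (simp add: character_def prod_norm[symmetric] norm_power_int unit_torus_def)

lemma compact_unit_torus: "compact (unit_torus :: (complex^'n) set)"
proof -
  have "norm z \<le> real CARD('n)" if "z \<in> unit_torus" for z :: "complex^'n"
  proof -
    have "norm z \<le> (\<Sum>k\<in>UNIV. cmod (z $ k))"
      by (simp add: norm_vec_def L2_set_le_sum)
    then show ?thesis using that by (simp add: unit_torus_def)
  qed
  then have "bounded (unit_torus :: (complex^'n) set)"
    by (auto simp: bounded_iff)
  moreover have "closed (unit_torus :: (complex^'n) set)"
    unfolding unit_torus_def by (intro closed_Collect_all closed_Collect_eq continuous_intros)
  ultimately show ?thesis by (simp add: compact_eq_bounded_closed)
qed

section \<open>Trigonometric polynomials and their density\<close>

definition trig_poly :: "(complex^'n \<Rightarrow> complex) \<Rightarrow> bool" where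
  "trig_poly f \<longleftrightarrow> (\<exists>A c. finite A \<and> (\<forall>z\<in>unit_torus. f z = (\<Sum>m\<in>A. c m * character m z)))"

lemma trig_poly_character: "trig_poly (\<lambda>z. c * character m z)"
  unfolding trig_poly_def by (intro exI[of _ "{m}"] exI[of _ "\<lambda>_. c"]) simp

lemma trig_poly_const: "trig_poly (\<lambda>_. c)"
  using trig_poly_character[of c "\<lambda>_. 0"] by simp

lemma trig_poly_cong: "trig_poly f \<Longrightarrow> (\<And>z. z \<in> unit_torus \<Longrightarrow> f z = g z) \<Longrightarrow> trig_poly g"
  unfolding trig_poly_def by simp

lemma trig_poly_add:
  assumes "trig_poly f" "trig_poly g"
  shows "trig_poly (\<lambda>z. f z + g z)"
proof -
  obtain A c B d where A: "finite A" "\<And>z. z \<in> unit_torus \<Longrightarrow> f z = (\<Sum>m\<in>A. c m * character m z)"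
    and B: "finite B" "\<And>z. z \<in> unit_torus \<Longrightarrow> g z = (\<Sum>m\<in>B. d m * character m z)"
    using assms unfolding trig_poly_def by metis
  let ?c = "\<lambda>m. (if m \<in> A then c m else 0) + (if m \<in> B then d m else 0)"
  have "f z + g z = (\<Sum>m\<in>A \<union> B. ?c m * character m z)" if z: "z \<in> unit_torus" for z
  proof -
    have "f z = (\<Sum>m\<in>A \<union> B. (if m \<in> A then c m else 0) * character m z)"
      unfolding A(2)[OF z] by (rule sum.mono_neutral_cong_left) (use A(1) B(1) in auto)
    moreover have "g z = (\<Sum>m\<in>A \<union> B. (if m \<in> B then d m else 0) * character m z)"
      unfolding B(2)[OF z] by (rule sum.mono_neutral_cong_left) (use A(1) B(1) in auto)
    ultimately show ?thesis by (simp only: distrib_right sum.distrib)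
  qed
  then show ?thesis
    unfolding trig_poly_def using A(1) B(1) by (intro exI[of _ "A \<union> B"] exI[of _ ?c]) auto
qed

lemma trig_poly_sum:
  assumes "finite I" "\<And>i. i \<in> I \<Longrightarrow> trig_poly (f i)"
  shows "trig_poly (\<lambda>z. \<Sum>i\<in>I. f i z)"
  using assms
proof (induction I rule: finite_induct)
  case empty
  then show ?case by (simp add: trig_poly_const)
next
  case (insert i I)
  then show ?case by (simp add: trig_poly_add)
qed

lemma trig_poly_mult:
  assumes "trig_poly f" "trig_poly g"
  shows "trig_poly (\<lambda>z. f z * g z)"
proof -
  obtain A c B d where A: "finite A" "\<And>z. z \<in> unit_torus \<Longrightarrow> f z = (\<Sum>m\<in>A. c m * character m z)"
    and B: "finite B" "\<And>z. z \<in> unit_torus \<Longrightarrow> g z = (\<Sum>m\<in>B. d m * character m z)"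
    using assms unfolding trig_poly_def by metis
  have "trig_poly (\<lambda>z. \<Sum>m\<in>A. \<Sum>n\<in>B. (c m * d n) * character (\<lambda>k. m k + n k) z)"
    by (intro trig_poly_sum A B trig_poly_character)
  then show ?thesis
    by (rule trig_poly_cong) (simp add: A B character_add sum_product mult_ac)
qed

text \<open>On \<open>unit_torus\<close> conjugating a coordinate inverts it, so the exponents 1 and
  -1 at \<open>k\<close> give both functions.\<close>

lemma trig_poly_component: "trig_poly (\<lambda>z::complex^'n. z $ k)"
  and trig_poly_cnj_component: "trig_poly (\<lambda>z::complex^'n. cnj (z $ k))"
proof -
  have *: "character (\<lambda>i. if i = k then j else 0) z = z $ k powi j" for j and z :: "complex^'n"
  proof -
    have "character (\<lambda>i. if i = k then j else 0) z = (\<Prod>i\<in>UNIV. if i = k then z $ i powi j else 1)"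
      unfolding character_def by (rule prod.cong) auto
    then show ?thesis by simp
  qed
  show "trig_poly (\<lambda>z :: complex^'n. z $ k)"
    using trig_poly_character[of 1 "\<lambda>i. if i = k then 1 else 0"] by (simp add: *)
  have "inverse (z $ k) = cnj (z $ k)" if "z \<in> unit_torus" for z :: "complex^'n"
    using that by (simp add: unit_torus_def inverse_complex_def complex_eq_iff cmod_def)
  then show "trig_poly (\<lambda>z :: complex^'n. cnj (z $ k))"
    by (intro trig_poly_cong[OF trig_poly_character[of 1 "\<lambda>i. if i = k then - 1 else 0"]])
       (simp add: * power_int_minus)
qed

text \<open>Stone-Weierstrass for the algebra of real-valued trigonometric polynomials; the real and
  imaginary parts of the coordinates belong to it and separate points.\<close>

lemma trig_poly_dense:
  fixes f :: "complex^'n \<Rightarrow> real"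
  assumes "continuous_on unit_torus f" "\<epsilon> > 0"
  obtains g where "trig_poly (\<lambda>z. complex_of_real (g z))" "\<And>z. z \<in> unit_torus \<Longrightarrow> \<bar>f z - g z\<bar> < \<epsilon>"
proof -
  let ?R = "{g. continuous_on unit_torus g \<and> trig_poly (\<lambda>z::complex^'n. complex_of_real (g z))}"
  interpret function_ring_on ?R unit_torus
  proof
    show "(\<lambda>x. f x + g x) \<in> ?R" "(\<lambda>x. f x * g x) \<in> ?R" if "f \<in> ?R" "g \<in> ?R" for f g
      using that by (auto intro!: continuous_intros trig_poly_add trig_poly_mult)
    show "(\<lambda>_. c) \<in> ?R" for c
      by (simp add: trig_poly_const)
    fix x y :: "complex^'n" assume "x \<noteq> y"
    then obtain k where k: "x $ k \<noteq> y $ k" by (auto simp: vec_eq_iff)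
    have "trig_poly (\<lambda>z::complex^'n. (1/2) * z $ k + (1/2) * cnj (z $ k))"
      "trig_poly (\<lambda>z::complex^'n. (- \<i>/2) * z $ k + (\<i>/2) * cnj (z $ k))"
      by (intro trig_poly_add trig_poly_mult trig_poly_const trig_poly_component trig_poly_cnj_component)+
    moreover have "(\<lambda>z::complex^'n. (1/2) * z $ k + (1/2) * cnj (z $ k)) = (\<lambda>z. of_real (Re (z $ k)))"
      "(\<lambda>z::complex^'n. (- \<i>/2) * z $ k + (\<i>/2) * cnj (z $ k)) = (\<lambda>z. of_real (Im (z $ k)))"
      by (auto simp: fun_eq_iff complex_eq_iff)
    ultimately have "(\<lambda>z. Re (z $ k)) \<in> ?R" "(\<lambda>z. Im (z $ k)) \<in> ?R"
      by (auto intro!: continuous_intros)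
    with k show "\<exists>f\<in>?R. f x \<noteq> f y"
      by (metis (no_types, lifting) complex_eq_iff)
  qed (auto simp: compact_unit_torus)
  show ?thesis
    using Stone_Weierstrass_basic[OF assms] that by auto
qed

text \<open>Finite averages over a subgroup \<open>K\<close>, which replace Haar measure.\<close>

definition averaging :: "(complex^'n) set \<Rightarrow> ((complex^'n \<Rightarrow> complex) \<Rightarrow> complex) \<Rightarrow> bool" where
  "averaging K \<Lambda> \<longleftrightarrow>
     (\<forall>f g. \<Lambda> (\<lambda>z. f z + g z) = \<Lambda> f + \<Lambda> g) \<and> (\<forall>c f. \<Lambda> (\<lambda>z. c * f z) = c * \<Lambda> f) \<and>
     (\<forall>f B. (\<forall>z\<in>K. cmod (f z) \<le> B) \<longrightarrow> cmod (\<Lambda> f) \<le> B) \<and> \<Lambda> (\<lambda>_. 1) = 1"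

lemma averaging_sum:
  assumes "averaging K \<Lambda>" "finite A"
  shows "\<Lambda> (\<lambda>z. \<Sum>m\<in>A. c m * f m z) = (\<Sum>m\<in>A. c m * \<Lambda> (f m))"
proof -
  have add: "\<And>f g. \<Lambda> (\<lambda>z. f z + g z) = \<Lambda> f + \<Lambda> g" and mul: "\<And>c f. \<Lambda> (\<lambda>z. c * f z) = c * \<Lambda> f"
    using assms(1) unfolding averaging_def by blast+
  have "\<Lambda> (\<lambda>_. 0) = 0" using mul[of 0 "\<lambda>_. 0"] by simp
  with assms(2) show ?thesis
    by (induction A rule: finite_induct) (simp_all add: add mul)
qed

text \<open>By induction on \<open>M\<close>. Averaging further over translates by powers of some
  \<open>g\<close> with \<open>character m g \<noteq> 1\<close> multiplies each
  \<open>\<Lambda> (character n)\<close> by the mean of the powers of \<open>character n g\<close>.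
  For \<open>n = m\<close> this is a geometric sum divided by its length, hence small; for the
  characters treated before, it has modulus at most 1.\<close>

lemma averaging_kills_characters:
  fixes K :: "(complex^'n) set"
  assumes K: "K \<subseteq> unit_torus" "1 \<in> K" "\<And>z w. z \<in> K \<Longrightarrow> w \<in> K \<Longrightarrow> z * w \<in> K"
    and "finite M" and "\<And>m. m \<in> M \<Longrightarrow> \<exists>z\<in>K. character m z \<noteq> 1" and \<epsilon>: "\<epsilon> > 0"
  shows "\<exists>\<Lambda>. averaging K \<Lambda> \<and> (\<forall>m\<in>M. cmod (\<Lambda> (character m)) \<le> \<epsilon>)"
  using assms(4,5)
proof (induction M rule: finite_induct)
  case empty
  have "averaging K (\<lambda>f. f 1)" using K(2) by (auto simp: averaging_def)
  then show ?case by blast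
next
  case (insert m M)
  obtain \<Lambda> where \<Lambda>: "averaging K \<Lambda>" "\<forall>m\<in>M. cmod (\<Lambda> (character m)) \<le> \<epsilon>"
    using insert by auto
  have add: "\<And>f g. \<Lambda> (\<lambda>z. f z + g z) = \<Lambda> f + \<Lambda> g" and mul: "\<And>c f. \<Lambda> (\<lambda>z. c * f z) = c * \<Lambda> f"
    and bd: "\<And>f B. (\<And>z. z \<in> K \<Longrightarrow> cmod (f z) \<le> B) \<Longrightarrow> cmod (\<Lambda> f) \<le> B" and one: "\<Lambda> (\<lambda>_. 1) = 1"
    using \<Lambda>(1) unfolding averaging_def by blast+
  obtain g where g: "g \<in> K" "character m g \<noteq> 1" using insert.prems by blast
  have gj: "g ^ j \<in> K" for j
    by (induction j) (auto simp: K g)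
  define w where "w = character m g"
  \<comment> \<open>The geometric sum has modulus at most \<open>2 / cmod (1 - w)\<close>, so this
    \<open>N\<close> brings its mean down to at most \<open>\<epsilon>\<close>.\<close>
  obtain N :: nat where N: "real N > 2 / (\<epsilon> * cmod (1 - w))" "N > 0"
  proof -
    obtain N :: nat where N: "real N > 2 / (\<epsilon> * cmod (1 - w))" using reals_Archimedean2 by blast
    moreover have "2 / (\<epsilon> * cmod (1 - w)) \<ge> 0" using \<epsilon> by simp
    ultimately have "N > 0" using of_nat_0_less_iff by fastforce
    with N show ?thesis using that by blast
  qed
  define \<Lambda>' where "\<Lambda>' f = (\<Sum>j<N. \<Lambda> (\<lambda>z. f (z * g ^ j))) / of_nat N" for f
  have "averaging K \<Lambda>'"
    unfolding averaging_def
  proof (intro conjI allI impI)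
    show "\<Lambda>' (\<lambda>z. f z + h z) = \<Lambda>' f + \<Lambda>' h" for f h
      by (simp add: \<Lambda>'_def add sum.distrib add_divide_distrib)
    show "\<Lambda>' (\<lambda>z. c * f z) = c * \<Lambda>' f" for c f
      by (simp add: \<Lambda>'_def mul flip: sum_distrib_left)
    show "\<Lambda>' (\<lambda>_. 1) = 1" using N(2) by (simp add: \<Lambda>'_def one)
    fix f B assume f: "\<forall>z\<in>K. cmod (f z) \<le> B"
    have "cmod (\<Sum>j<N. \<Lambda> (\<lambda>z. f (z * g ^ j))) \<le> (\<Sum>j<N. B)"
      by (intro sum_norm_le bd) (use f K(3) gj in auto)
    then show "cmod (\<Lambda>' f) \<le> B"
      using N(2) by (simp add: \<Lambda>'_def norm_divide field_simps)
  qed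
  moreover have \<Lambda>'_char: "\<Lambda>' (character n) = \<Lambda> (character n) * ((\<Sum>j<N. character n g ^ j) / of_nat N)" for n
    unfolding \<Lambda>'_def by (simp add: character_mult character_power mul mult.commute[of "character n _"] flip: sum_distrib_left sum_distrib_right)
  have abs1: "cmod (\<Lambda> (character n)) \<le> 1" for n
    using K(1) by (intro bd) (auto simp: norm_character)
  have "cmod (\<Lambda>' (character m)) \<le> \<epsilon>"
  proof -
    have w: "w \<noteq> 1" "cmod w = 1" using g K(1) by (auto simp: w_def norm_character)
    have "cmod (\<Sum>j<N. w ^ j) = cmod (1 - w ^ N) / cmod (1 - w)"
      using w(1) by (simp add: sum_gp_strict norm_divide)
    also have "cmod (1 - w ^ N) \<le> 2"
      using norm_triangle_ineq4[of 1 "w ^ N"] w(2) by (simp add: norm_power)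
    finally have "cmod (\<Sum>j<N. w ^ j) \<le> 2 / cmod (1 - w)"
      by (simp add: divide_right_mono)
    also have "\<dots> \<le> \<epsilon> * N"
      using N(1) \<epsilon> w(1) by (simp add: field_simps)
    finally have "cmod ((\<Sum>j<N. w ^ j) / of_nat N) \<le> \<epsilon>"
      using N(2) by (simp add: norm_divide field_simps)
    then have "cmod (\<Lambda> (character m)) * cmod ((\<Sum>j<N. w ^ j) / of_nat N) \<le> 1 * \<epsilon>"
      by (intro mult_mono abs1) auto
    then show ?thesis unfolding \<Lambda>'_char w_def norm_mult by simp
  qed
  moreover have "cmod (\<Lambda>' (character n)) \<le> \<epsilon>" if "n \<in> M" for n
  proof -
    have "cmod (\<Sum>j<N. character n g ^ j) \<le> (\<Sum>j<N. 1)"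
      by (rule sum_norm_le) (use g K(1) in \<open>auto simp: norm_power norm_character\<close>)
    then have "cmod ((\<Sum>j<N. character n g ^ j) / of_nat N) \<le> 1"
      using N(2) by (simp add: norm_divide field_simps)
    then have "cmod (\<Lambda> (character n)) * cmod ((\<Sum>j<N. character n g ^ j) / of_nat N) \<le> \<epsilon> * 1"
      using \<Lambda>(2) that \<epsilon> by (intro mult_mono) auto
    then show ?thesis unfolding \<Lambda>'_char norm_mult by simp
  qed
  ultimately show ?case by blast
qed

text \<open>If \<open>u\<close> were outside \<open>K\<close>, a continuous function equal to 0 on
  \<open>K\<close> and 1 on the coset of \<open>u\<close> would be close to a trigonometric
  polynomial \<open>g\<close>. Averaged over \<open>K\<close>, the difference
  \<open>g (u * z) - g z\<close> is close to 1. But characters trivial on \<open>K\<close> cancel in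
  it, and the others average to almost 0.\<close>

lemma character_duality:
  fixes K :: "(complex^'n) set"
  assumes K: "K \<subseteq> unit_torus" "1 \<in> K" "\<And>z w. z \<in> K \<Longrightarrow> w \<in> K \<Longrightarrow> z * w \<in> K"
      "\<And>z. z \<in> K \<Longrightarrow> (\<chi> k. inverse (z $ k)) \<in> K" "closed K"
    and u: "u \<in> unit_torus" "\<And>m. (\<And>z. z \<in> K \<Longrightarrow> character m z = 1) \<Longrightarrow> character m u = 1"
  shows "u \<in> K"
proof (rule ccontr)
  assume uK: "u \<notin> K"
  let ?K' = "(\<lambda>z. u * z) ` K"
  have uz: "u * z \<in> unit_torus" if "z \<in> K" for z
    using that u(1) K(1) by (auto simp: unit_torus_def norm_mult)
  have "compact K"
    using K(1,5) compact_unit_torus by (metis compact_Int_closed inf.absorb_iff2)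
  then have "compact ?K'"
    by (intro compact_continuous_image continuous_intros)
  moreover have "K \<inter> ?K' = {}"
  proof -
    have False if "z \<in> K" "u * z \<in> K" for z
    proof -
      have "(u * z) * (\<chi> k. inverse (z $ k)) = u"
        using that(1) K(1) unit_torus_nonzero[of z] by (auto simp: vec_eq_iff)
      then show False using K(3)[OF that(2) K(4)[OF that(1)]] uK by simp
    qed
    then show ?thesis by blast
  qed
  ultimately obtain f :: "complex^'n \<Rightarrow> real" where f: "continuous_on UNIV f"
      "\<And>x. x \<in> K \<Longrightarrow> f x = 0" "\<And>x. x \<in> ?K' \<Longrightarrow> f x = 1"
    using Urysohn[of K ?K' 0 1] K(5) compact_imp_closed by metis
  obtain g where g: "trig_poly (\<lambda>z. complex_of_real (g z))" "\<And>z. z \<in> unit_torus \<Longrightarrow> \<bar>f z - g z\<bar> < 1/8"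
    using trig_poly_dense[of f "1/8"] continuous_on_subset[OF f(1)] by auto
  obtain A c where A: "finite A" and c: "\<And>z. z \<in> unit_torus \<Longrightarrow> of_real (g z) = (\<Sum>m\<in>A. c m * character m z)"
    using g(1) unfolding trig_poly_def by auto
  \<comment> \<open>\<open>d m\<close> are the coefficients of \<open>g (u * z) - g z\<close> in
    \<open>z\<close>. They vanish, or multiply a character trivial on \<open>K\<close> by 0, outside
    \<open>M\<close>. The tolerance \<open>1 / (4 * (C + 1))\<close> bounds the average of
    \<open>?h\<close> by 1/4, while \<open>?h\<close> is within 1/4 of 1 on
    \<open>K\<close>.\<close>
  define M where "M = {m\<in>A. \<exists>z\<in>K. character m z \<noteq> 1}"
  define d where "d m = c m * (character m u - 1)" for m
  define C where "C = (\<Sum>m\<in>M. cmod (d m))"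
  have M: "finite M" "M \<subseteq> A" using A by (auto simp: M_def)
  have C: "C \<ge> 0" unfolding C_def by (intro sum_nonneg) auto
  obtain \<Lambda> where \<Lambda>: "averaging K \<Lambda>" "\<And>m. m \<in> M \<Longrightarrow> cmod (\<Lambda> (character m)) \<le> 1 / (4 * (C + 1))"
    using averaging_kills_characters[OF K(1-3) M(1), of "1 / (4 * (C + 1))"] C by (auto simp: M_def)
  let ?h = "\<lambda>z. \<Sum>m\<in>M. d m * character m z"
  have h: "?h z = of_real (g (u * z)) - of_real (g z)" if z: "z \<in> K" for z
  proof -
    have "of_real (g (u * z)) - of_real (g z) = (\<Sum>m\<in>A. d m * character m z)"
      using z K(1) by (auto simp: c uz character_mult d_def algebra_simps sum_subtractf)
    also have "\<dots> = ?h z"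
      by (rule sum.mono_neutral_right) (use A M u(2) in \<open>auto simp: M_def d_def\<close>)
    finally show ?thesis by simp
  qed
  have add: "\<And>f g. \<Lambda> (\<lambda>z. f z + g z) = \<Lambda> f + \<Lambda> g" and mul: "\<And>c f. \<Lambda> (\<lambda>z. c * f z) = c * \<Lambda> f"
    and bd: "\<And>f B. (\<And>z. z \<in> K \<Longrightarrow> cmod (f z) \<le> B) \<Longrightarrow> cmod (\<Lambda> f) \<le> B" and one: "\<Lambda> (\<lambda>_. 1) = 1"
    using \<Lambda>(1) unfolding averaging_def by blast+
  have "cmod (\<Lambda> (\<lambda>z. ?h z + (- 1) * 1)) \<le> 1/4"
  proof (rule bd)
    fix z assume z: "z \<in> K"
    have "?h z + (- 1) * 1 = of_real (g (u * z) - g z - 1)" using h[OF z] by simp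
    moreover have "\<bar>g (u * z) - g z - 1\<bar> \<le> 1/4"
    proof -
      have "\<bar>1 - g (u * z)\<bar> < 1/8" "\<bar>0 - g z\<bar> < 1/8"
        using g(2)[OF uz[OF z]] g(2)[of z] f(2)[OF z] f(3)[of "u * z"] z K(1) by auto
      then show ?thesis by linarith
    qed
    ultimately show "cmod (?h z + (- 1) * 1) \<le> 1/4" by (simp only: norm_of_real)
  qed
  then have "cmod (\<Lambda> ?h - 1) \<le> 1/4" unfolding add mul one by simp
  moreover have "cmod (\<Lambda> ?h) \<le> 1/4"
  proof -
    have "\<Lambda> ?h = (\<Sum>m\<in>M. d m * \<Lambda> (character m))"
      by (rule averaging_sum[OF \<Lambda>(1) M(1)])
    also have "cmod \<dots> \<le> (\<Sum>m\<in>M. cmod (d m) * (1 / (4 * (C + 1))))"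
      by (rule sum_norm_le) (simp only: norm_mult mult_left_mono \<Lambda>(2) norm_ge_zero)
    also have "\<dots> = C * (1 / (4 * (C + 1)))" unfolding C_def by (rule sum_distrib_right[symmetric])
    also have "\<dots> \<le> 1/4" using C by (simp add: field_simps)
    finally show ?thesis .
  qed
  ultimately show False
    using norm_triangle_ineq4[of "\<Lambda> ?h" "\<Lambda> ?h - 1"] by simp
qed

section \<open>Maximum principles for polynomials on torus orbits\<close>

text \<open>The factor \<open>exp (\<epsilon> * w\<^sup>2)\<close> decays as \<open>Im w\<close>
  grows, so for a bounded function the maximum principle on a tall rectangle suffices; then
  \<open>\<epsilon>\<close> tends to 0.\<close>

lemma maximum_modulus_strip:
  fixes h :: "complex \<Rightarrow> complex"
  assumes hol: "h holomorphic_on UNIV"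
    and M: "\<And>w. 0 \<le> Re w \<Longrightarrow> Re w \<le> R \<Longrightarrow> cmod (h w) \<le> M"
    and B: "\<And>w. Re w = 0 \<or> Re w = R \<Longrightarrow> cmod (h w) \<le> B"
    and w: "0 \<le> Re w" "Re w \<le> R"
  shows "cmod (h w) \<le> B"
proof -
  have "cmod (h 0) \<le> B" by (rule B) simp
  then have B0: "B \<ge> 0" using norm_ge_zero order_trans by blast
  have M0: "M \<ge> 0" using M[OF w] norm_ge_zero order_trans by blast
  have bound: "cmod (h w) * exp (\<epsilon> * Re (w\<^sup>2)) \<le> (B + \<epsilon>) * exp (\<epsilon> * R\<^sup>2)" if \<epsilon>: "\<epsilon> > 0" for \<epsilon>
  proof -
    \<comment> \<open>The maximum puts \<open>w\<close> into the rectangle and gives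
      \<open>M \<le> \<epsilon>\<^sup>2 * Y\<close>; the summand 1 ensures
      \<open>Y \<le> Y\<^sup>2\<close>. Together with \<open>exp x \<ge> x\<close> this makes the
      horizontal edges harmless.\<close>
    define Y where "Y = max (\<bar>Im w\<bar>) (M / \<epsilon>\<^sup>2) + 1"
    have Y: "Y \<ge> 1" "\<bar>Im w\<bar> \<le> Y" "M / \<epsilon>\<^sup>2 \<le> Y"
      using \<epsilon> M0 by (auto simp: Y_def)
    have MY: "M \<le> \<epsilon> * exp (\<epsilon> * Y\<^sup>2)"
    proof -
      have "Y * 1 \<le> Y * Y" using Y by (intro mult_left_mono) auto
      then have "M / \<epsilon>\<^sup>2 \<le> Y * Y" using Y(3) by simp
      then have "M \<le> \<epsilon> * (\<epsilon> * Y\<^sup>2)" using \<epsilon> by (simp add: field_simps power2_eq_square)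
      also have "\<dots> \<le> \<epsilon> * exp (\<epsilon> * Y\<^sup>2)"
        using \<epsilon> exp_ge_add_one_self[of "\<epsilon> * Y\<^sup>2"] by (intro mult_left_mono) linarith+
      finally show ?thesis .
    qed
    let ?g = "\<lambda>z. h z * exp (of_real \<epsilon> * z\<^sup>2)"
    let ?S = "cbox (Complex 0 (- Y)) (Complex R Y)"
    have norm_g: "cmod (?g z) = cmod (h z) * exp (\<epsilon> * ((Re z)\<^sup>2 - (Im z)\<^sup>2))" for z
      by (simp add: norm_mult power2_eq_square)
    have "?g holomorphic_on UNIV" by (intro holomorphic_intros hol)
    then have g: "?g holomorphic_on S" for S by (rule holomorphic_on_subset) simp
    have front: "cmod (?g z) \<le> (B + \<epsilon>) * exp (\<epsilon> * R\<^sup>2)" if "z \<in> frontier ?S" for z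
    proof -
      have z: "0 \<le> Re z" "Re z \<le> R" "\<bar>Im z\<bar> \<le> Y" "Re z = 0 \<or> Re z = R \<or> \<bar>Im z\<bar> = Y"
        using that unfolding frontier_cbox by (auto simp: in_cbox_complex_iff in_box_complex_iff)
      have Re2: "(Re z)\<^sup>2 \<le> R\<^sup>2" using z by (intro power_mono)
      show ?thesis
      proof (cases "\<bar>Im z\<bar> = Y")
        case True
        then have Im2: "(Im z)\<^sup>2 = Y\<^sup>2" by (metis power2_abs)
        have "cmod (?g z) \<le> (\<epsilon> * exp (\<epsilon> * Y\<^sup>2)) * exp (\<epsilon> * (R\<^sup>2 - Y\<^sup>2))"
          unfolding norm_g Im2 using M[OF z(1,2)] MY Re2 \<epsilon> M0 by (intro mult_mono) auto
        also have "\<dots> = \<epsilon> * exp (\<epsilon> * R\<^sup>2)" by (simp add: algebra_simps flip: exp_add)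
        also have "\<dots> \<le> (B + \<epsilon>) * exp (\<epsilon> * R\<^sup>2)" using B0 by (intro mult_right_mono) auto
        finally show ?thesis .
      next
        case False
        then have "cmod (h z) \<le> B" using z B by blast
        moreover have "(Re z)\<^sup>2 - (Im z)\<^sup>2 \<le> R\<^sup>2" using Re2 zero_le_power2[of "Im z"] by linarith
        ultimately show ?thesis
          unfolding norm_g using \<epsilon> B0 by (intro mult_mono) auto
      qed
    qed
    have wS: "w \<in> ?S" using w Y by (auto simp: in_cbox_complex_iff)
    have "cmod (?g w) \<le> (B + \<epsilon>) * exp (\<epsilon> * R\<^sup>2)"
      by (rule maximum_modulus_frontier[OF g holomorphic_on_imp_continuous_on[OF g] bounded_cbox front wS])
    then show ?thesis unfolding norm_g by (simp add: power2_eq_square)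
  qed
  have l1: "((\<lambda>\<epsilon>. cmod (h w) * exp (\<epsilon> * Re (w\<^sup>2))) \<longlongrightarrow> cmod (h w) * exp (0 * Re (w\<^sup>2))) (at_right 0)"
    and l2: "((\<lambda>\<epsilon>. (B + \<epsilon>) * exp (\<epsilon> * R\<^sup>2)) \<longlongrightarrow> (B + 0) * exp (0 * R\<^sup>2)) (at_right 0)"
    by (intro tendsto_intros)+
  have ev: "\<forall>\<^sub>F \<epsilon> in at_right 0. cmod (h w) * exp (\<epsilon> * Re (w\<^sup>2)) \<le> (B + \<epsilon>) * exp (\<epsilon> * R\<^sup>2)"
    using eventually_at_right_less[of "0::real"] by eventually_elim (rule bound)
  show ?thesis
    using tendsto_le[OF _ l2 l1 ev] by simp
qed

text \<open>The factor \<open>exp (- \<epsilon> * w)\<close> makes a bounded function at most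
  \<open>\<epsilon>\<close> on a far vertical line, which reduces the half-plane to a strip; then
  \<open>\<epsilon>\<close> tends to 0.\<close>

lemma maximum_modulus_half_plane:
  fixes h :: "complex \<Rightarrow> complex"
  assumes hol: "h holomorphic_on UNIV"
    and M: "\<And>w. 0 \<le> Re w \<Longrightarrow> cmod (h w) \<le> M"
    and B: "\<And>w. Re w = 0 \<Longrightarrow> cmod (h w) \<le> B"
    and w: "0 \<le> Re w"
  shows "cmod (h w) \<le> B"
proof -
  have "cmod (h 0) \<le> B" by (rule B) simp
  then have B0: "B \<ge> 0" using norm_ge_zero order_trans by blast
  have M0: "M \<ge> 0" using M[OF w] norm_ge_zero order_trans by blast
  have bound: "cmod (h w) * exp (- \<epsilon> * Re w) \<le> B + \<epsilon>" if \<epsilon>: "\<epsilon> > 0" for \<epsilon>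
  proof -
    \<comment> \<open>The first entry places \<open>w\<close> in the strip; the second gives
      \<open>M \<le> \<epsilon>\<^sup>2 * R \<le> \<epsilon> * exp (\<epsilon> * R)\<close>.\<close>
    define R where "R = max (Re w) (M / \<epsilon>\<^sup>2)"
    have "M / \<epsilon>\<^sup>2 \<le> R" by (simp add: R_def)
    then have "M \<le> \<epsilon> * (\<epsilon> * R)" using \<epsilon> by (simp add: field_simps power2_eq_square)
    also have "\<dots> \<le> \<epsilon> * exp (\<epsilon> * R)"
      using \<epsilon> exp_ge_add_one_self[of "\<epsilon> * R"] by (intro mult_left_mono) linarith+
    finally have MR: "M * exp (- \<epsilon> * R) \<le> \<epsilon>"
      by (simp add: exp_minus field_simps)
    let ?g = "\<lambda>z. h z * exp (- of_real \<epsilon> * z)"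
    have norm_g: "cmod (?g z) = cmod (h z) * exp (- \<epsilon> * Re z)" for z
      by (simp add: norm_mult)
    have "cmod (?g w) \<le> B + \<epsilon>"
    proof (rule maximum_modulus_strip[of ?g R M])
      show "?g holomorphic_on UNIV" by (intro holomorphic_intros hol)
      show "cmod (?g z) \<le> M" if "0 \<le> Re z" for z
      proof -
        have "cmod (?g z) \<le> M * 1"
          unfolding norm_g using M[OF that] that \<epsilon> M0 by (intro mult_mono) auto
        then show ?thesis by simp
      qed
      show "cmod (?g z) \<le> B + \<epsilon>" if "Re z = 0 \<or> Re z = R" for z
      proof (cases "Re z = 0")
        case True
        then show ?thesis unfolding norm_g using B[OF True] \<epsilon> by simp
      next
        case False
        have "R \<ge> 0" using w by (simp add: R_def)
        with False that have "cmod (?g z) \<le> M * exp (- \<epsilon> * R)"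
          unfolding norm_g using M[of z] M0 by (intro mult_mono) auto
        then show ?thesis using MR B0 by simp
      qed
    qed (use w in \<open>auto simp: R_def\<close>)
    then show ?thesis unfolding norm_g .
  qed
  have l1: "((\<lambda>\<epsilon>. cmod (h w) * exp (- \<epsilon> * Re w)) \<longlongrightarrow> cmod (h w) * exp (- 0 * Re w)) (at_right 0)"
    and l2: "((\<lambda>\<epsilon>. B + \<epsilon>) \<longlongrightarrow> B + 0) (at_right 0)"
    by (intro tendsto_intros)+
  have ev: "\<forall>\<^sub>F \<epsilon> in at_right 0. cmod (h w) * exp (- \<epsilon> * Re w) \<le> B + \<epsilon>"
    using eventually_at_right_less[of "0::real"] by eventually_elim (rule bound)
  show ?thesis
    using tendsto_le[OF _ l2 l1 ev] by simp
qed

text \<open>Supplies the a priori bound \<open>M\<close> that both maximum principles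
  demand.\<close>

lemma polynomial_fun_bounded:
  assumes "polynomial_fun p"
  shows "\<exists>M. \<forall>z. (\<forall>k. cmod (z $ k) \<le> r k) \<longrightarrow> cmod (p z) \<le> M"
proof -
  obtain A c where A: "finite A" "\<And>z. p z = (\<Sum>\<alpha>\<in>A. c \<alpha> * (\<Prod>k\<in>UNIV. (z $ k) ^ \<alpha> k))"
    using assms unfolding polynomial_fun_def by blast
  have "cmod (p z) \<le> (\<Sum>\<alpha>\<in>A. cmod (c \<alpha>) * (\<Prod>k\<in>UNIV. r k ^ \<alpha> k))" if "\<And>k. cmod (z $ k) \<le> r k" for z
    unfolding A(2)
  proof (rule sum_norm_le)
    fix \<alpha>
    have "(\<Prod>k\<in>UNIV. cmod (z $ k) ^ \<alpha> k) \<le> (\<Prod>k\<in>UNIV. r k ^ \<alpha> k)"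
      by (intro prod_mono conjI power_mono that zero_le_power norm_ge_zero)
    then show "cmod (c \<alpha> * (\<Prod>k\<in>UNIV. z $ k ^ \<alpha> k)) \<le> cmod (c \<alpha>) * (\<Prod>k\<in>UNIV. r k ^ \<alpha> k)"
      by (simp add: norm_mult norm_power prod_norm[symmetric] mult_left_mono)
  qed
  then show ?thesis by blast
qed

lemma holomorphic_on_polynomial_fun:
  assumes "polynomial_fun p" "\<And>k. (\<lambda>w. f w $ k) holomorphic_on S"
  shows "(\<lambda>w. p (f w)) holomorphic_on S"
proof -
  obtain A c where A: "finite A" "\<And>z. p z = (\<Sum>\<alpha>\<in>A. c \<alpha> * (\<Prod>k\<in>UNIV. (z $ k) ^ \<alpha> k))"
    using assms unfolding polynomial_fun_def by blast
  show ?thesis unfolding A(2) by (intro holomorphic_intros assms(2))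
qed

lemma continuous_on_polynomial_fun:
  assumes "polynomial_fun p"
  shows "continuous_on S p"
proof -
  obtain A c where A: "finite A" "\<And>z. p z = (\<Sum>\<alpha>\<in>A. c \<alpha> * (\<Prod>k\<in>UNIV. (z $ k) ^ \<alpha> k))"
    using assms unfolding polynomial_fun_def by blast
  show ?thesis unfolding A(2) by (intro continuous_intros)
qed

lemma C_cone_iff: "x \<in> C_cone T \<longleftrightarrow> x \<in> real_lie_alg T \<and> (\<forall>k. x $ k \<le> 0)"
proof -
  have "closure (uminus ` {x. \<forall>k. 0 < x $ k}) = {x::real^'a. \<forall>k. x $ k \<le> 0}" (is "closure ?N = ?C")
  proof
    show "closure ?N \<subseteq> ?C"
    proof (rule closure_minimal)
      show "?N \<subseteq> ?C" by (auto intro: less_imp_le)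
      show "closed ?C" by (intro closed_Collect_all closed_Collect_le continuous_intros)
    qed
    show "?C \<subseteq> closure ?N"
    proof
      fix x :: "real^'a" assume x: "x \<in> ?C"
      have "(\<lambda>n. x - inverse (real (Suc n)) *\<^sub>R 1) \<longlonglongrightarrow> x - 0 *\<^sub>R 1"
        by (intro tendsto_intros LIMSEQ_inverse_real_of_nat)
      moreover have "x - inverse (real (Suc n)) *\<^sub>R 1 \<in> ?N" for n
      proof (rule image_eqI)
        show "- x + inverse (real (Suc n)) *\<^sub>R 1 \<in> {x. \<forall>k. 0 < x $ k}"
        proof -
          have "0 < - x $ k + inverse (real (Suc n))" for k
            using x by (intro add_nonneg_pos) auto
          then show ?thesis by simp
        qed
      qed simp
      ultimately show "x \<in> closure ?N"
        unfolding closure_sequential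
        by (intro exI[of _ "\<lambda>n. x - inverse (real (Suc n)) *\<^sub>R 1"]) simp
    qed
  qed
  then show ?thesis by (auto simp: C_cone_def)
qed

lemma polynomial_fun_bound_convex_hull_plus_cone:
  fixes T :: "(complex^'n) set"
  assumes T: "is_torus T" and F: "F \<subseteq> real_lie_alg T" and p: "polynomial_fun p"
    and B: "\<And>t x. t \<in> T \<Longrightarrow> x \<in> F \<Longrightarrow> cmod (p (t * rexp x * v)) \<le> B"
    and t: "t \<in> T" and x: "x \<in> convex hull F + C_cone T"
  shows "cmod (p (t * rexp x * v)) \<le> B"
proof -
  let ?V = "real_lie_alg T"
  define D where "D = {x\<in>?V. \<forall>t\<in>T. cmod (p (t * rexp x * v)) \<le> B}"
  have V: "subspace ?V" by (rule subspace_real_lie_alg[OF T])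
  \<comment> \<open>A curve holomorphic in \<open>w\<close>. If \<open>d\<close> lies in the Lie
    algebra, \<open>Im w\<close> only moves the point inside its \<open>T\<close>-orbit, so a bound
    on one orbit is a bound on a whole vertical line.\<close>
  define \<gamma> where "\<gamma> t a d w = t * (\<chi> k. exp (of_real (a $ k) + w * of_real (d $ k))) * v"
    for t and a d :: "real^'n" and w
  have \<gamma>: "\<gamma> t a d w = (t * iexp (Im w *\<^sub>R d)) * rexp (a + Re w *\<^sub>R d) * v" for t a d w
  proof -
    have "exp (of_real a + w * of_real d) = cis (Im w * d) * of_real (exp (a + Re w * d))" for a d :: real
      by (simp add: exp_eq_polar mult.commute)
    then show ?thesis by (simp add: \<gamma>_def vec_eq_iff)
  qed
  have norm_\<gamma>: "cmod (\<gamma> t a d w $ k) = exp (a $ k + Re w * d $ k) * cmod (v $ k)" if "t \<in> T" for t a d w k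
    using that T by (auto simp: \<gamma> norm_mult is_torus_def unit_torus_def)
  have hol: "(\<lambda>w. p (\<gamma> t a d w)) holomorphic_on UNIV" for t a d
    unfolding \<gamma>_def by (rule holomorphic_on_polynomial_fun[OF p]) (auto intro!: holomorphic_intros)
  have edge: "cmod (p (\<gamma> t a d w)) \<le> B" if "t \<in> T" "d \<in> ?V" "a + Re w *\<^sub>R d \<in> D" for t a d w
  proof -
    have "t * iexp (Im w *\<^sub>R d) \<in> T" using that T by (auto simp: is_torus_def real_lie_alg_iff)
    then show ?thesis using that(3) unfolding \<gamma> D_def by blast
  qed
  have "convex D"
    unfolding convex_alt
  proof (intro ballI allI impI)
    fix a b and s :: real assume ab: "a \<in> D" "b \<in> D" and s: "0 \<le> s \<and> s \<le> 1"
    have abV: "a \<in> ?V" "b \<in> ?V" using ab by (auto simp: D_def)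
    have d: "b - a \<in> ?V" using V abV by (intro subspace_diff)
    have "cmod (p (t * rexp ((1 - s) *\<^sub>R a + s *\<^sub>R b) * v)) \<le> B" if t: "t \<in> T" for t
    proof -
      obtain M where M: "\<forall>z. (\<forall>k. cmod (z $ k) \<le> exp (a $ k + \<bar>(b - a) $ k\<bar>) * cmod (v $ k)) \<longrightarrow> cmod (p z) \<le> M"
        using polynomial_fun_bounded[OF p, of "\<lambda>k. exp (a $ k + \<bar>(b - a) $ k\<bar>) * cmod (v $ k)"] by blast
      have "cmod (p (\<gamma> t a (b - a) (of_real s))) \<le> B"
      proof (rule maximum_modulus_strip[where h = "\<lambda>w. p (\<gamma> t a (b - a) w)" and R = 1])
        show "cmod (p (\<gamma> t a (b - a) w)) \<le> M" if "0 \<le> Re w" "Re w \<le> 1" for w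
        proof (rule M[rule_format])
          fix k
          have "Re w * (b - a) $ k \<le> \<bar>Re w * (b - a) $ k\<bar>" by simp
          also have "\<dots> \<le> 1 * \<bar>(b - a) $ k\<bar>"
            unfolding abs_mult using that by (intro mult_right_mono) auto
          finally show "cmod (\<gamma> t a (b - a) w $ k) \<le> exp (a $ k + \<bar>(b - a) $ k\<bar>) * cmod (v $ k)"
            unfolding norm_\<gamma>[OF t] by (intro mult_right_mono) auto
        qed
        show "cmod (p (\<gamma> t a (b - a) w)) \<le> B" if "Re w = 0 \<or> Re w = 1" for w
          using that ab by (intro edge t d) auto
      qed (use s hol in auto)
      moreover have "a + s *\<^sub>R (b - a) = (1 - s) *\<^sub>R a + s *\<^sub>R b" by (simp add: algebra_simps)
      ultimately show ?thesis by (simp add: \<gamma>)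
    qed
    moreover have "(1 - s) *\<^sub>R a + s *\<^sub>R b \<in> ?V"
      using V abV by (intro subspace_add subspace_scale)
    ultimately show "(1 - s) *\<^sub>R a + s *\<^sub>R b \<in> D" by (simp add: D_def)
  qed
  moreover have "F \<subseteq> D" using F B by (auto simp: D_def)
  ultimately have QD: "convex hull F \<subseteq> D" by (rule hull_minimal[rotated])
  obtain a d where ad: "x = a + d" "a \<in> D" "d \<in> C_cone T"
    using x QD by (auto elim!: set_plus_elim)
  have dV: "d \<in> ?V" and d0: "\<And>k. d $ k \<le> 0" using ad(3) by (auto simp: C_cone_iff)
  \<comment> \<open>As \<open>d\<close> has no positive coordinate, moving right in the half-plane
    does not increase the coordinate moduli, so the polynomial stays bounded there.\<close>
  obtain M where M: "\<forall>z. (\<forall>k. cmod (z $ k) \<le> exp (a $ k) * cmod (v $ k)) \<longrightarrow> cmod (p z) \<le> M"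
    using polynomial_fun_bounded[OF p, of "\<lambda>k. exp (a $ k) * cmod (v $ k)"] by blast
  have "cmod (p (\<gamma> t a d 1)) \<le> B"
  proof (rule maximum_modulus_half_plane[where h = "\<lambda>w. p (\<gamma> t a d w)"])
    show "cmod (p (\<gamma> t a d w)) \<le> M" if "0 \<le> Re w" for w
    proof (rule M[rule_format])
      show "cmod (\<gamma> t a d w $ k) \<le> exp (a $ k) * cmod (v $ k)" for k
        unfolding norm_\<gamma>[OF t] using mult_nonneg_nonpos[OF that d0] by (intro mult_right_mono) auto
    qed
    show "cmod (p (\<gamma> t a d w)) \<le> B" if "Re w = 0" for w
      using that ad by (intro edge t dV) auto
  qed (use hol in auto)
  then show ?thesis by (simp add: \<gamma> ad(1))
qed

section \<open>Separation and polynomial hulls\<close>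

text \<open>Let \<open>E\<close> be the orthogonal complement of \<open>V\<close> with the
  coordinates outside \<open>Z\<close> set free, and \<open>\<Delta>\<close> the simplex on the unit
  vectors of \<open>Z\<close>. A common point yields \<open>\<eta>\<close>. Otherwise a separating
  normal \<open>a\<close> annihilates \<open>E\<close>, hence lies in \<open>V\<close> and vanishes
  outside \<open>Z\<close>; being positive on \<open>\<Delta>\<close>, it gives
  \<open>\<xi> = - a\<close>.\<close>

lemma subspace_alternative:
  fixes V :: "(real^'n) set"
  assumes V: "subspace V"
  shows "(\<exists>\<xi>\<in>V. (\<forall>k. k \<notin> Z \<longrightarrow> \<xi> $ k = 0) \<and> (\<forall>k\<in>Z. \<xi> $ k < 0)) \<or>
         (\<exists>\<eta>. (\<forall>x\<in>V. inner \<eta> x = 0) \<and> (\<forall>k\<in>Z. \<eta> $ k \<ge> 0) \<and> (\<exists>k\<in>Z. \<eta> $ k > 0))"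
proof (cases "Z = {}")
  case True
  then show ?thesis using subspace_0[OF V] by (intro disjI1 bexI[of _ 0]) auto
next
  case Z: False
  define \<Delta> where "\<Delta> = convex hull ((\<lambda>k. axis k 1) ` Z :: (real^'n) set)"
  define E where "E = {e. \<exists>\<eta>\<in>V\<^sup>\<bottom>. \<forall>k\<in>Z. e $ k = \<eta> $ k}"
  have "compact \<Delta>"
    unfolding \<Delta>_def by (intro compact_convex_hull finite_imp_compact finite_imageI) simp
  then have \<Delta>: "convex \<Delta>" "compact \<Delta>" "\<Delta> \<noteq> {}"
    using Z by (auto simp: \<Delta>_def)
  have \<Delta>_sub: "\<Delta> \<subseteq> {x. (\<forall>k. x $ k \<ge> 0) \<and> (\<Sum>k\<in>Z. x $ k) = 1}"
    unfolding \<Delta>_def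
  proof (rule hull_minimal)
    show "convex {x::real^'n. (\<forall>k. x $ k \<ge> 0) \<and> (\<Sum>k\<in>Z. x $ k) = 1}"
    proof (rule convexI)
      fix x y :: "real^'n" and s t :: real
      assume *: "x \<in> {x. (\<forall>k. x $ k \<ge> 0) \<and> (\<Sum>k\<in>Z. x $ k) = 1}" "y \<in> {x. (\<forall>k. x $ k \<ge> 0) \<and> (\<Sum>k\<in>Z. x $ k) = 1}"
        "0 \<le> s" "0 \<le> t" "s + t = 1"
      then show "s *\<^sub>R x + t *\<^sub>R y \<in> {x. (\<forall>k. x $ k \<ge> 0) \<and> (\<Sum>k\<in>Z. x $ k) = 1}"
        by (simp add: sum.distrib flip: sum_distrib_left)
    qed
    show "(\<lambda>k. axis k 1) ` Z \<subseteq> {x::real^'n. (\<forall>k. x $ k \<ge> 0) \<and> (\<Sum>k\<in>Z. x $ k) = 1}"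
      by (auto simp: axis_def)
  qed
  have Vp: "subspace (V\<^sup>\<bottom>)" by (rule subspace_orthogonal_comp)
  have E: "subspace E"
    unfolding subspace_def
  proof (intro conjI ballI allI)
    show "0 \<in> E" unfolding E_def using subspace_0[OF Vp] by (auto intro!: bexI[of _ 0])
    fix x assume "x \<in> E"
    then obtain a where a: "a \<in> V\<^sup>\<bottom>" "\<forall>k\<in>Z. x $ k = a $ k" by (auto simp: E_def)
    show "c *\<^sub>R x \<in> E" for c
      unfolding E_def using a subspace_scale[OF Vp a(1), of c] by (auto intro!: bexI[of _ "c *\<^sub>R a"])
    fix y assume "y \<in> E"
    then obtain b where b: "b \<in> V\<^sup>\<bottom>" "\<forall>k\<in>Z. y $ k = b $ k" by (auto simp: E_def)
    show "x + y \<in> E"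
      unfolding E_def using a b subspace_add[OF Vp a(1) b(1)] by (auto intro!: bexI[of _ "a + b"])
  qed
  show ?thesis
  proof (cases "E \<inter> \<Delta> = {}")
    case False
    then obtain e \<eta> where e: "e \<in> \<Delta>" "\<eta> \<in> V\<^sup>\<bottom>" "\<forall>k\<in>Z. e $ k = \<eta> $ k" by (auto simp: E_def)
    have e1: "\<forall>k. e $ k \<ge> 0" "(\<Sum>k\<in>Z. e $ k) = 1" using e(1) \<Delta>_sub by auto
    have "\<exists>k\<in>Z. e $ k > 0"
    proof (rule ccontr)
      assume "\<not> ?thesis"
      then have "(\<Sum>k\<in>Z. e $ k) \<le> 0" by (intro sum_nonpos) (auto simp: not_less)
      then show False using e1(2) by simp
    qed
    moreover have "\<forall>x\<in>V. inner \<eta> x = 0"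
      using e(2) by (auto simp: orthogonal_comp_def orthogonal_def inner_commute)
    moreover have "\<forall>k\<in>Z. \<eta> $ k \<ge> 0" using e(3) e1(1) by metis
    ultimately show ?thesis using e(3) by (intro disjI2 exI[of _ \<eta>]) auto
  next
    case True
    obtain a b where ab: "\<forall>x\<in>E. inner a x < b" "\<forall>x\<in>\<Delta>. inner a x > b"
      using separating_hyperplane_closed_compact[OF subspace_imp_convex[OF E] closed_subspace[OF E] \<Delta> True] by blast
    have b0: "b > 0" using ab(1) subspace_0[OF E] by auto
    \<comment> \<open>A linear functional bounded above on a subspace is zero there: otherwise a
      multiple of \<open>x\<close> would attain \<open>b\<close>.\<close>
    have aE: "inner a x = 0" if "x \<in> E" for x
    proof (rule ccontr)
      assume "inner a x \<noteq> 0"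
      then have "inner a ((b / inner a x) *\<^sub>R x) = b" by simp
      then show False using ab(1) subspace_scale[OF E that, of "b / inner a x"] by (metis less_irrefl)
    qed
    have "a \<in> V\<^sup>\<bottom>\<^sup>\<bottom>"
      unfolding orthogonal_comp_def[of "V\<^sup>\<bottom>"] orthogonal_def
    proof (intro CollectI ballI)
      fix y assume "y \<in> V\<^sup>\<bottom>"
      then have "y \<in> E" by (auto simp: E_def)
      then show "inner y a = 0" using aE[of y] inner_commute[of a y] by simp
    qed
    then have "a \<in> V" by (simp add: orthogonal_comp_self[OF V])
    then have "- a \<in> V" by (rule subspace_neg[OF V])
    moreover have "(- a) $ k = 0" if "k \<notin> Z" for k
    proof -
      have "axis k 1 \<in> E"
        unfolding E_def using that subspace_0[OF Vp] by (auto intro!: bexI[of _ 0] simp: axis_def)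
      then show ?thesis using aE by (metis inner_axis inner_real_def mult.right_neutral neg_equal_zero vector_uminus_component add.inverse_neutral)
    qed
    moreover have "(- a) $ k < 0" if "k \<in> Z" for k
    proof -
      have "axis k 1 \<in> \<Delta>" unfolding \<Delta>_def using that by (intro hull_inc) auto
      then have "inner a (axis k 1) > b" using ab(2) by blast
      then show ?thesis using b0 by (simp add: inner_axis)
    qed
    ultimately show ?thesis by (intro disjI1 bexI[of _ "- a"]) auto
  qed
qed

text \<open>Separates \<open>Q\<close> from the set \<open>U\<close> of points above
  \<open>x0\<close> on \<open>S\<close>. Raising coordinates in \<open>S\<close> and changing the
  others arbitrarily stays in \<open>U\<close>, which forces the normal to be nonnegative and to
  vanish off \<open>S\<close>.\<close>

lemma convex_compact_dominates:
  fixes Q :: "(real^'n) set"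
  assumes Q: "convex Q" "compact Q" "Q \<noteq> {}"
    and no: "\<not> (\<exists>q\<in>Q. \<forall>k\<in>S. x0 $ k \<le> q $ k)"
  obtains a b where "\<And>k. a $ k \<ge> 0" "\<And>k. k \<notin> S \<Longrightarrow> a $ k = 0" "inner a x0 > b" "\<And>q. q \<in> Q \<Longrightarrow> inner a q < b"
proof -
  define U where "U = {y. \<forall>k\<in>S. x0 $ k \<le> y $ k}"
  have "convex U"
    unfolding U_def
  proof (rule convexI)
    fix x y and s t :: real
    assume *: "x \<in> {y. \<forall>k\<in>S. x0 $ k \<le> y $ k}" "y \<in> {y. \<forall>k\<in>S. x0 $ k \<le> y $ k}" "0 \<le> s" "0 \<le> t" "s + t = 1"
    have "x0 $ k \<le> s * x $ k + t * y $ k" if "k \<in> S" for k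
    proof -
      have "s * x0 $ k + t * x0 $ k \<le> s * x $ k + t * y $ k"
        using * that by (intro add_mono mult_left_mono) auto
      then show ?thesis using *(5) by (metis distrib_right mult_1)
    qed
    then show "s *\<^sub>R x + t *\<^sub>R y \<in> {y. \<forall>k\<in>S. x0 $ k \<le> y $ k}" by simp
  qed
  moreover have "closed U"
    unfolding U_def Ball_def by (intro closed_Collect_all closed_Collect_imp closed_Collect_le open_Collect_const continuous_intros)
  moreover have "Q \<inter> U = {}" using no by (auto simp: U_def)
  ultimately obtain a b where ab: "\<forall>x\<in>Q. inner a x < b" "\<forall>x\<in>U. inner a x > b"
    using separating_hyperplane_compact_closed[OF Q] by blast
  have x0: "x0 + axis k c \<in> U" if "k \<in> S \<Longrightarrow> c \<ge> 0" for k c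
    using that by (auto simp: U_def axis_def)
  have gt: "inner a x0 + a $ k * c > b" if "k \<in> S \<Longrightarrow> c \<ge> 0" for k c
  proof -
    have "inner a (x0 + axis k c) > b" using ab(2) x0[OF that] by blast
    then show ?thesis by (simp add: inner_add_right inner_axis)
  qed
  have x0b: "inner a x0 > b" using gt[of undefined 0] by simp
  have nonneg: "a $ k \<ge> 0" for k
  proof (rule ccontr)
    assume "\<not> ?thesis"
    then have "a $ k < 0" by simp
    \<comment> \<open>Shifting the \<open>k\<close>-th coordinate by this amount brings the
      functional down to exactly \<open>b\<close>, against the strict inequality on
      \<open>U\<close>.\<close>
    then have "(inner a x0 - b) / - a $ k \<ge> 0" "a $ k * ((inner a x0 - b) / - a $ k) = b - inner a x0"
      using x0b by (auto simp: field_simps)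
    then show False using gt[of k "(inner a x0 - b) / - a $ k"] by simp
  qed
  have "a $ k = 0" if "k \<notin> S" for k
  proof (rule ccontr)
    assume "a $ k \<noteq> 0"
    then have "a $ k * ((inner a x0 - b) / - a $ k) = b - inner a x0" by (auto simp: field_simps)
    then show False using gt[of k "(inner a x0 - b) / - a $ k"] that by simp
  qed
  with nonneg x0b ab(1) that show ?thesis by blast
qed

section \<open>Polynomial hulls, monomials and binomials\<close>

lemma polynomial_hullD:
  assumes "z \<in> polynomial_hull Y" "polynomial_fun p" "Y \<noteq> {}" "\<And>y. y \<in> Y \<Longrightarrow> cmod (p y) \<le> B"
  shows "cmod (p z) \<le> B"
proof -
  have "cmod (p z) \<le> (SUP w\<in>Y. cmod (p w))" using assms(1,2) by (simp add: polynomial_hull_def)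
  also have "\<dots> \<le> B" using assms(3,4) by (rule cSUP_least)
  finally show ?thesis .
qed

text \<open>Compactness bounds the values of \<open>p\<close> above, so the supremum is itself an
  admissible \<open>B\<close>.\<close>

lemma polynomial_hullI:
  assumes "compact Y"
    and "\<And>p B. polynomial_fun p \<Longrightarrow> (\<And>y. y \<in> Y \<Longrightarrow> cmod (p y) \<le> B) \<Longrightarrow> cmod (p z) \<le> B"
  shows "z \<in> polynomial_hull Y"
  unfolding polynomial_hull_def
proof (intro CollectI allI impI)
  fix p :: "complex^'a \<Rightarrow> complex" assume p: "polynomial_fun p"
  have "compact ((\<lambda>w. cmod (p w)) ` Y)"
    using assms(1) continuous_on_polynomial_fun[OF p] by (intro compact_continuous_image continuous_intros)
  then have "bdd_above ((\<lambda>w. cmod (p w)) ` Y)"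
    by (intro bounded_imp_bdd_above compact_imp_bounded)
  then show "cmod (p z) \<le> (SUP w\<in>Y. cmod (p w))"
    using assms(2)[OF p] by (meson cSUP_upper)
qed

lemma closed_polynomial_hull: "closed (polynomial_hull Y)"
proof -
  have "closed {z. polynomial_fun p \<longrightarrow> cmod (p z) \<le> (SUP w\<in>Y. cmod (p w))}" for p
  proof (cases "polynomial_fun p")
    case True
    then show ?thesis
      by (simp add: closed_Collect_le continuous_intros continuous_on_polynomial_fun)
  qed simp
  then show ?thesis unfolding polynomial_hull_def by (intro closed_Collect_all)
qed

lemma monomial_quotient:
  "(\<Prod>k\<in>UNIV. (z $ k / v $ k) ^ \<alpha> k) = inverse (\<Prod>k\<in>UNIV. v $ k ^ \<alpha> k) * (\<Prod>k\<in>UNIV. z $ k ^ \<alpha> k)"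
  for z v :: "complex^'n"
  unfolding power_divide prod_dividef by (simp add: divide_inverse mult.commute)

lemma polynomial_fun_monomial: "polynomial_fun (\<lambda>z. \<Prod>k\<in>UNIV. (z $ k / v $ k) ^ \<alpha> k)"
  unfolding polynomial_fun_def
  by (intro exI[of _ "{\<alpha>}"] exI[of _ "\<lambda>_. inverse (\<Prod>k\<in>UNIV. v $ k ^ \<alpha> k)"]) (simp add: monomial_quotient)

lemma polynomial_fun_binomial:
  "polynomial_fun (\<lambda>z. (\<Prod>k\<in>UNIV. (z $ k / v $ k) ^ \<alpha> k) - (\<Prod>k\<in>UNIV. (z $ k / v $ k) ^ \<beta> k))"
\<comment> \<open>Equal exponents would collapse the index set \<open>{\<alpha>, \<beta>}\<close> to
  one monomial with the wrong coefficient.\<close>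
proof (cases "\<alpha> = \<beta>")
  case True
  then show ?thesis unfolding polynomial_fun_def by (intro exI[of _ "{}"]) simp
next
  case False
  then show ?thesis
    unfolding polynomial_fun_def monomial_quotient
    by (intro exI[of _ "{\<alpha>, \<beta>}"] exI[of _ "\<lambda>\<gamma>. if \<gamma> = \<alpha> then inverse (\<Prod>k\<in>UNIV. v $ k ^ \<alpha> k)
          else - inverse (\<Prod>k\<in>UNIV. v $ k ^ \<beta> k)"]) auto
qed

text \<open>Since \<open>nat\<close> truncates at 0, at least one of the two powers is 1. This turns
  a relation between Laurent monomials into one between ordinary monomials.\<close>

lemma power_int_eq_divide: "a \<noteq> 0 \<Longrightarrow> a powi m = a ^ nat m / a ^ nat (- m)" for a :: "'a::field"
  by (simp add: power_int_def field_simps)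

lemma character_iexp: "character m (iexp x) = cis (inner (ivec m) x)"
proof -
  have "(\<Prod>k\<in>A. cis (f k)) = cis (\<Sum>k\<in>A. f k)" for A and f :: "'b \<Rightarrow> real"
    by (induction A rule: infinite_finite_induct) (auto simp: cis_mult)
  then show ?thesis by (simp add: character_def cis_power_int inner_vec_real)
qed

section \<open>The hull of finitely many orbits\<close>

text \<open>\<open>F\<close> stands for the logarithms of \<open>X\<close>. Keeping it as a
  parameter allows a second use with a single exponent, that is, for one orbit.\<close>

locale torus_orbits =
  fixes T :: "(complex^'n) set" and v :: "complex^'n" and F :: "(real^'n) set"
  assumes torus: "is_torus T" and T_iexp: "T \<subseteq> iexp ` real_lie_alg T"
    and v: "\<And>k. v $ k \<noteq> 0" and F: "finite F" "F \<noteq> {}" "F \<subseteq> real_lie_alg T"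
begin

abbreviation "V \<equiv> real_lie_alg T"
abbreviation "Y \<equiv> T * rexp ` F * {v}"
abbreviation "P \<equiv> convex hull F + C_cone T"

lemma V: "subspace V"
  by (rule subspace_real_lie_alg[OF torus])

lemma T_facts: "T \<subseteq> unit_torus" "1 \<in> T" "\<And>s t. s \<in> T \<Longrightarrow> t \<in> T \<Longrightarrow> s * t \<in> T"
  "\<And>t. t \<in> T \<Longrightarrow> (\<chi> k. inverse (t $ k)) \<in> T" "closed T"
  using torus by (auto simp: is_torus_def)

lemma compact_T: "compact T"
  using T_facts(1,5) compact_unit_torus by (metis compact_Int_closed inf.absorb_iff2)

lemma Y_iff: "y \<in> Y \<longleftrightarrow> (\<exists>t\<in>T. \<exists>x\<in>F. y = t * rexp x * v)"
  by (auto simp: set_times_def)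

lemma compact_Y: "compact Y"
proof -
  have "Y = (\<Union>x\<in>F. (\<lambda>t. t * rexp x * v) ` T)"
    unfolding set_eq_iff Y_iff by blast
  then show ?thesis
    using F(1) compact_T by (auto intro!: compact_continuous_image continuous_intros)
qed

lemma Y_nonempty: "Y \<noteq> {}"
  using F(2) T_facts(2) by (force simp: set_times_def)

section \<open>From exponents in \<open>P\<close> and their limits into the hull\<close>

lemma closure_subset_hull: "closure (T * rexp ` P * {v}) \<subseteq> polynomial_hull Y"
proof (rule closure_minimal[OF _ closed_polynomial_hull], rule subsetI)
  fix z assume "z \<in> T * rexp ` P * {v}"
  then obtain t x where z: "z = t * rexp x * v" "t \<in> T" "x \<in> P"
    by (auto simp: set_times_def)
  show "z \<in> polynomial_hull Y"
  proof (rule polynomial_hullI[OF compact_Y])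
    fix p B assume p: "polynomial_fun p" "\<And>y. y \<in> Y \<Longrightarrow> cmod (p y) \<le> B"
    show "cmod (p z) \<le> B"
      unfolding z(1) using polynomial_fun_bound_convex_hull_plus_cone[OF torus F(3) p(1) _ z(2,3)] p(2) Y_iff
      by blast
  qed
qed

lemma P_add_ray:
  assumes "x \<in> P" "\<xi> \<in> C_cone T" "r \<ge> 0"
  shows "x + r *\<^sub>R \<xi> \<in> P"
proof -
  obtain q c where x: "x = q + c" "q \<in> convex hull F" "c \<in> C_cone T"
    using assms(1) by (auto elim: set_plus_elim)
  have "c + r *\<^sub>R \<xi> \<in> C_cone T"
    using x(3) assms(2,3) V by (auto simp: C_cone_iff intro!: subspace_add subspace_scale add_nonpos_nonpos mult_nonneg_nonpos)
  then show ?thesis using x(2) by (auto simp: x(1) add.assoc)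
qed

text \<open>With \<open>l\<close> the limit of \<open>rexp (r *\<^sub>R \<xi>)\<close>, the point
  \<open>t * rexp x * l * v\<close> is the limit of
  \<open>t * rexp (x + r *\<^sub>R \<xi>) * v\<close>, and the exponents of these stay in
  \<open>P\<close>.\<close>

lemma I_set_subset_closure: "T * rexp ` P * I_set T * {v} \<subseteq> closure (T * rexp ` P * {v})"
proof
  fix z assume "z \<in> T * rexp ` P * I_set T * {v}"
  then obtain t x l where z: "z = t * rexp x * l * v" "t \<in> T" "x \<in> P" "l \<in> I_set T"
    by (auto simp: set_times_def)
  obtain \<xi> where \<xi>: "\<xi> \<in> C_cone T" "((\<lambda>r::real. rexp (r *\<^sub>R \<xi>)) \<longlongrightarrow> l) at_top"
    using z(4) by (auto simp: I_set_def)
  have "((\<lambda>r::real. t * rexp x * rexp (r *\<^sub>R \<xi>) * v) \<longlongrightarrow> t * rexp x * l * v) at_top"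
    by (rule vec_tendstoI) (auto intro!: tendsto_intros tendsto_vec_nth[OF \<xi>(2)] simp del: rexp_component)
  then show "z \<in> closure (T * rexp ` P * {v})"
    unfolding z(1)
  proof (rule Lim_in_closed_set[OF closed_closure, rotated 2])
    show "\<forall>\<^sub>F r in at_top. t * rexp x * rexp (r *\<^sub>R \<xi>) * v \<in> closure (T * rexp ` P * {v})"
      using eventually_ge_at_top[of 0]
    proof eventually_elim
      case (elim r)
      have "t * rexp x * rexp (r *\<^sub>R \<xi>) * v = t * rexp (x + r *\<^sub>R \<xi>) * v"
        by (simp add: rexp_add mult.assoc)
      also have "\<dots> \<in> T * rexp ` P * {v}"
        using z(2) P_add_ray[OF z(3) \<xi>(1) elim] by (auto intro!: set_times_intro)
      finally show ?case using closure_subset by blast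
    qed
  qed simp
qed

section \<open>Monomial relations on the hull and the reverse inclusion\<close>

lemma monomial_on_Y:
  assumes "y = t * rexp x * v" "t \<in> T"
  shows "cmod (\<Prod>k\<in>UNIV. (y $ k / v $ k) ^ \<alpha> k) = exp (\<Sum>k\<in>UNIV. of_nat (\<alpha> k) * x $ k)"
proof -
  have "cmod (y $ k / v $ k) = exp (x $ k)" for k
    using assms T_facts(1) v[of k] by (auto simp: norm_mult norm_divide unit_torus_def)
  then show ?thesis by (simp add: prod_norm[symmetric] norm_power exp_sum exp_of_nat_mult)
qed

text \<open>A point of \<open>Y\<close> divided by \<open>v\<close> is the exponential of
  \<open>x + \<i> s\<close> with \<open>x\<close> and \<open>s\<close> in \<open>V\<close>, both
  orthogonal to \<open>ivec m\<close>, so the difference of the two monomials vanishes on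
  \<open>Y\<close>. The bound 0 passes to the hull.\<close>

lemma hull_binomial:
  assumes z: "z \<in> polynomial_hull Y" and m: "\<And>x. x \<in> V \<Longrightarrow> inner (ivec m) x = 0"
  shows "(\<Prod>k\<in>UNIV. (z $ k / v $ k) ^ nat (m k)) = (\<Prod>k\<in>UNIV. (z $ k / v $ k) ^ nat (- m k))"
proof -
  have "cmod ((\<Prod>k\<in>UNIV. (z $ k / v $ k) ^ nat (m k)) - (\<Prod>k\<in>UNIV. (z $ k / v $ k) ^ nat (- m k))) \<le> 0"
  proof (rule polynomial_hullD[OF z polynomial_fun_binomial Y_nonempty])
    fix y assume "y \<in> Y"
    then obtain t x where y: "t \<in> T" "x \<in> F" "y = t * rexp x * v" using Y_iff by blast
    obtain s where s: "s \<in> V" "t = iexp s" using y(1) T_iexp by blast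
    have yk: "y $ k / v $ k = exp (Complex (x $ k) (s $ k))" for k
      using v[of k] by (simp add: y(3) s(2) exp_eq_polar[of "Complex _ _"] mult.commute)
    have prod: "(\<Prod>k\<in>UNIV. (y $ k / v $ k) ^ \<alpha> k) = exp (\<Sum>k\<in>UNIV. of_nat (\<alpha> k) * Complex (x $ k) (s $ k))" for \<alpha>
      by (simp add: yk exp_sum exp_of_nat_mult)
    have "(\<Sum>k\<in>UNIV. of_nat (nat (m k)) * Complex (x $ k) (s $ k)) - (\<Sum>k\<in>UNIV. of_nat (nat (- m k)) * Complex (x $ k) (s $ k))
        = (\<Sum>k\<in>UNIV. of_int (m k) * Complex (x $ k) (s $ k))"
      unfolding sum_subtractf[symmetric] left_diff_distrib[symmetric]
    proof (intro sum.cong refl arg_cong2[where f = "(*)"])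
      show "of_nat (nat (m k)) - of_nat (nat (- m k)) = complex_of_int (m k)" for k
        by (cases "m k \<ge> 0") simp_all
    qed
    also have "\<dots> = Complex (inner (ivec m) x) (inner (ivec m) s)"
      by (simp add: complex_eq_iff inner_vec_real)
    also have "\<dots> = 0" using m[OF s(1)] m[of x] y(2) F(3) by (auto simp: complex_eq_iff)
    finally show "cmod ((\<Prod>k\<in>UNIV. (y $ k / v $ k) ^ nat (m k)) - (\<Prod>k\<in>UNIV. (y $ k / v $ k) ^ nat (- m k))) \<le> 0"
      unfolding prod by simp
  qed
  then show ?thesis by simp
qed

text \<open>Otherwise \<open>subspace_alternative\<close> gives an annihilator \<open>\<eta>\<close>
  of \<open>V\<close>, nonnegative on the zeros of \<open>z\<close> and positive at a zero
  \<open>j\<close>. An integer approximation \<open>m\<close> keeps these signs; then only the left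
  side of \<open>hull_binomial\<close> vanishes at \<open>z\<close>.\<close>

lemma hull_zeros_direction:
  assumes z: "z \<in> polynomial_hull Y"
  obtains \<xi> where "\<xi> \<in> V" "\<And>k. z $ k \<noteq> 0 \<Longrightarrow> \<xi> $ k = 0" "\<And>k. z $ k = 0 \<Longrightarrow> \<xi> $ k < 0"
proof -
  let ?Z = "{k. z $ k = 0}"
  have "\<not> (\<exists>\<eta>. (\<forall>x\<in>V. inner \<eta> x = 0) \<and> (\<forall>k\<in>?Z. \<eta> $ k \<ge> 0) \<and> (\<exists>k\<in>?Z. \<eta> $ k > 0))"
  proof
    assume "\<exists>\<eta>. (\<forall>x\<in>V. inner \<eta> x = 0) \<and> (\<forall>k\<in>?Z. \<eta> $ k \<ge> 0) \<and> (\<exists>k\<in>?Z. \<eta> $ k > 0)"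
    then obtain \<eta> j where \<eta>: "\<And>x. x \<in> V \<Longrightarrow> inner \<eta> x = 0" "\<And>k. z $ k = 0 \<Longrightarrow> \<eta> $ k \<ge> 0"
      and j: "z $ j = 0" "\<eta> $ j > 0" by auto
    \<comment> \<open>An error below 1 turns \<open>\<eta> $ k \<ge> 0\<close> into
      \<open>m k > - 1\<close>, so \<open>m k \<ge> 0\<close> by integrality; an error below
      \<open>\<eta> $ j\<close> keeps \<open>m j\<close> positive.\<close>
    obtain q m where q: "(0::int) < q" and m: "\<And>x. x \<in> V \<Longrightarrow> inner (ivec m) x = 0"
      and qm: "\<And>k. \<bar>(of_int q *\<^sub>R \<eta> - ivec m) $ k\<bar> < min 1 (\<eta> $ j)"
      using real_lie_alg_annihilator_approx[OF torus \<eta>(1), of "min 1 (\<eta> $ j)"] j(2) by auto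
    have q1: "real_of_int q \<ge> 1" using q by simp
    have m0: "m k \<ge> 0" if "z $ k = 0" for k
    proof -
      have "real_of_int q * \<eta> $ k \<ge> 0" using \<eta>(2)[OF that] q by simp
      moreover have "\<bar>real_of_int q * \<eta> $ k - of_int (m k)\<bar> < 1" using qm[of k] by simp
      ultimately have "real_of_int (m k) > - 1" by linarith
      then show ?thesis by linarith
    qed
    have mj: "m j > 0"
    proof -
      have "1 * \<eta> $ j \<le> real_of_int q * \<eta> $ j" using q1 j(2) by (intro mult_right_mono) auto
      moreover have "\<bar>real_of_int q * \<eta> $ j - of_int (m j)\<bar> < \<eta> $ j" using qm[of j] by simp
      ultimately have "real_of_int (m j) > 0" by linarith
      then show ?thesis by simp
    qed
    have "(\<Prod>k\<in>UNIV. (z $ k / v $ k) ^ nat (m k)) = 0"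
      using j(1) mj by (auto intro!: bexI[of _ j])
    moreover have "(\<Prod>k\<in>UNIV. (z $ k / v $ k) ^ nat (- m k)) \<noteq> 0"
      using v m0 by (auto simp: zero_less_nat_eq dest: m0)
    ultimately show False using hull_binomial[OF z m] by simp
  qed
  then have "\<exists>\<xi>\<in>V. (\<forall>k. k \<notin> ?Z \<longrightarrow> \<xi> $ k = 0) \<and> (\<forall>k\<in>?Z. \<xi> $ k < 0)"
    using subspace_alternative[OF V, of ?Z] by blast
  then show ?thesis using that by auto
qed

text \<open>The value 1 at the zeros of \<open>z\<close> keeps all coordinates invertible, so that
  characters and logarithms can be applied.\<close>

definition quot :: "complex^'n \<Rightarrow> complex^'n" where
  "quot z = (\<chi> k. if z $ k = 0 then 1 else z $ k / v $ k)"

lemma quot_nonzero: "quot z $ k \<noteq> 0"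
  using v by (simp add: quot_def)

text \<open>The exponents vanish where \<open>quot z\<close> differs from \<open>z / v\<close>, so
  \<open>hull_binomial\<close> holds for \<open>quot z\<close>, and there it can be divided
  out.\<close>

lemma hull_character_quot:
  assumes z: "z \<in> polynomial_hull Y" and m: "\<And>x. x \<in> V \<Longrightarrow> inner (ivec m) x = 0"
    and m0: "\<And>k. z $ k = 0 \<Longrightarrow> m k = 0"
  shows "character m (quot z) = 1"
proof -
  have eq: "(\<Prod>k\<in>UNIV. (quot z $ k) ^ \<alpha> k) = (\<Prod>k\<in>UNIV. (z $ k / v $ k) ^ \<alpha> k)"
    if "\<And>k. z $ k = 0 \<Longrightarrow> \<alpha> k = 0" for \<alpha>
    by (rule prod.cong) (auto simp: quot_def that)
  have "character m (quot z) = (\<Prod>k\<in>UNIV. (quot z $ k) ^ nat (m k)) / (\<Prod>k\<in>UNIV. (quot z $ k) ^ nat (- m k))"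
    unfolding character_def by (simp add: power_int_eq_divide[OF quot_nonzero] prod_dividef)
  also have "(\<Prod>k\<in>UNIV. (quot z $ k) ^ nat (m k)) = (\<Prod>k\<in>UNIV. (quot z $ k) ^ nat (- m k))"
    using hull_binomial[OF z m] m0 by (simp add: eq)
  finally show ?thesis using quot_nonzero by simp
qed

lemma hull_norm_character_quot:
  assumes "z \<in> polynomial_hull Y" and "\<And>x. x \<in> V \<Longrightarrow> inner (ivec m) x = 0"
    and "\<And>k. z $ k = 0 \<Longrightarrow> m k = 0"
  shows "(\<Prod>k\<in>UNIV. cmod (quot z $ k) powi m k) = 1"
  using arg_cong[OF hull_character_quot[OF assms], of cmod]
  by (simp add: character_def prod_norm[symmetric] norm_power_int)

text \<open>If the logarithms \<open>y\<close> of the moduli agreed with no element of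
  \<open>V\<close> on the support of \<open>z\<close>, their part \<open>\<eta>\<close> orthogonal
  to \<open>W\<close> would annihilate \<open>V\<close> and vanish off the support. An integer
  vector \<open>m\<close> near \<open>q *\<^sub>R \<eta>\<close> satisfies
  \<open>inner (ivec m) y = 0\<close>, whereas \<open>inner \<eta> y = inner \<eta> \<eta>\<close>
  is too large for the error.\<close>

lemma hull_modulus:
  assumes z: "z \<in> polynomial_hull Y"
  obtains x where "x \<in> V" "\<And>k. z $ k \<noteq> 0 \<Longrightarrow> exp (x $ k) = cmod (quot z $ k)"
proof -
  define y where "y = (\<chi> k. ln (cmod (quot z $ k)))"
  define W where "W = {w. \<exists>x\<in>V. \<forall>k. z $ k \<noteq> 0 \<longrightarrow> w $ k = x $ k}"
  have W: "subspace W"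
    unfolding subspace_def
  proof (intro conjI ballI allI)
    show "0 \<in> W" unfolding W_def using subspace_0[OF V] by (auto intro!: bexI[of _ 0])
    fix x assume "x \<in> W"
    then obtain a where a: "a \<in> V" "\<forall>k. z $ k \<noteq> 0 \<longrightarrow> x $ k = a $ k" by (auto simp: W_def)
    show "c *\<^sub>R x \<in> W" for c
      unfolding W_def using a subspace_scale[OF V a(1), of c] by (auto intro!: bexI[of _ "c *\<^sub>R a"])
    fix y assume "y \<in> W"
    then obtain b where b: "b \<in> V" "\<forall>k. z $ k \<noteq> 0 \<longrightarrow> y $ k = b $ k" by (auto simp: W_def)
    show "x + y \<in> W"
      unfolding W_def using a b subspace_add[OF V a(1) b(1)] by (auto intro!: bexI[of _ "a + b"])
  qed
  have "y \<in> W"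
  proof (rule ccontr)
    assume yW: "y \<notin> W"
    obtain a \<eta> where a\<eta>: "a \<in> span W" "\<And>w. w \<in> span W \<Longrightarrow> orthogonal \<eta> w" "y = a + \<eta>"
      using orthogonal_subspace_decomp_exists[of W y] by blast
    have sW: "span W = W" using W by (simp add: span_eq_iff)
    have \<eta>0: "inner \<eta> \<eta> > 0" using a\<eta> yW sW by auto
    have \<eta>W: "inner \<eta> w = 0" if "w \<in> W" for w using a\<eta>(2) that sW by (auto simp: orthogonal_def)
    have \<eta>V: "inner \<eta> x = 0" if "x \<in> V" for x using \<eta>W[of x] that by (auto simp: W_def)
    have \<eta>z: "\<eta> $ k = 0" if "z $ k = 0" for k
    proof -
      have "axis k 1 \<in> W" unfolding W_def using that subspace_0[OF V] by (auto intro!: bexI[of _ 0] simp: axis_def)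
      then have "inner \<eta> (axis k 1) = 0" by (rule \<eta>W)
      then show ?thesis by (simp add: inner_axis)
    qed
    define s where "s = (\<Sum>k\<in>UNIV. \<bar>y $ k\<bar>)"
    have s0: "s \<ge> 0" unfolding s_def by (intro sum_nonneg) auto
    \<comment> \<open>The entry 1 forces \<open>m k = 0\<close> wherever
      \<open>\<eta> $ k = 0\<close>; the other entry keeps the total error against \<open>y\<close>
      below \<open>inner \<eta> \<eta>\<close>.\<close>
    define \<epsilon> where "\<epsilon> = min 1 (inner \<eta> \<eta> / (1 + s))"
    have \<epsilon>: "\<epsilon> > 0" using \<eta>0 s0 by (simp add: \<epsilon>_def)
    have \<epsilon>s: "\<epsilon> * s < inner \<eta> \<eta>"
    proof -
      have "\<epsilon> * s \<le> inner \<eta> \<eta> / (1 + s) * s" using s0 by (intro mult_right_mono) (auto simp: \<epsilon>_def)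
      also have "\<dots> < inner \<eta> \<eta>" using s0 \<eta>0 by (simp add: field_simps)
      finally show ?thesis .
    qed
    obtain q m where q: "(0::int) < q" and m: "\<And>x. x \<in> V \<Longrightarrow> inner (ivec m) x = 0"
      and qm: "\<And>k. \<bar>(of_int q *\<^sub>R \<eta> - ivec m) $ k\<bar> < \<epsilon>"
      using real_lie_alg_annihilator_approx[OF torus \<eta>V \<epsilon>] by blast
    have m0: "m k = 0" if "z $ k = 0" for k
    proof -
      have "\<bar>real_of_int (m k)\<bar> < 1" using qm[of k] \<eta>z[OF that] by (auto simp: \<epsilon>_def)
      then show ?thesis by linarith
    qed
    have "ln (a powi j) = of_int j * ln a" if "a > 0" for a :: real and j
      using that powr_real_of_int'[of a j] ln_powr[of a "of_int j"] by simp
    then have "inner (ivec m) y = ln (\<Prod>k\<in>UNIV. cmod (quot z $ k) powi m k)"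
      using quot_nonzero[of z] by (simp add: inner_vec_real y_def ln_prod)
    then have my: "inner (ivec m) y = 0" using hull_norm_character_quot[OF z m m0] by simp
    have "inner \<eta> y = inner \<eta> \<eta>" using \<eta>W[of a] a\<eta>(1) sW by (simp add: a\<eta>(3) inner_add_right)
    then have "of_int q * inner \<eta> \<eta> = inner (of_int q *\<^sub>R \<eta> - ivec m) y"
      using my by (simp add: inner_diff_left)
    also have "\<dots> \<le> (\<Sum>k\<in>UNIV. \<bar>(of_int q *\<^sub>R \<eta> - ivec m) $ k * y $ k\<bar>)"
      unfolding inner_vec_real by (intro sum_mono) simp
    also have "\<dots> \<le> (\<Sum>k\<in>UNIV. \<epsilon> * \<bar>y $ k\<bar>)"
      unfolding abs_mult by (intro sum_mono mult_right_mono less_imp_le[OF qm]) auto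
    also have "\<dots> = \<epsilon> * s" by (simp add: s_def sum_distrib_left)
    finally have "of_int q * inner \<eta> \<eta> < 1 * inner \<eta> \<eta>" using \<epsilon>s by simp
    then have "real_of_int q < 1" using \<eta>0 by simp
    then show False using q by linarith
  qed
  then obtain x where x: "x \<in> V" "\<And>k. z $ k \<noteq> 0 \<Longrightarrow> y $ k = x $ k" by (auto simp: W_def)
  have "exp (x $ k) = cmod (quot z $ k)" if "z $ k \<noteq> 0" for k
    using x(2)[OF that] quot_nonzero[of z k] by (simp add: y_def flip: x(2)[OF that])
  with x(1) that show ?thesis by blast
qed

text \<open>Duality is applied to \<open>K\<close>, which is \<open>T\<close> with the phases off
  the support of \<open>z\<close> set free. A character trivial on \<open>K\<close> has exponent 0
  off the support and annihilates \<open>V\<close>, so it is 1 at \<open>quot z\<close> and at its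
  phases.\<close>

lemma hull_phase:
  assumes z: "z \<in> polynomial_hull Y"
  obtains t where "t \<in> T" "\<And>k. z $ k \<noteq> 0 \<Longrightarrow> t $ k = sgn (quot z $ k)"
proof -
  define K where "K = {w \<in> unit_torus. \<exists>t\<in>T. \<forall>k. z $ k \<noteq> 0 \<longrightarrow> t $ k = w $ k}"
  define u where "u = (\<chi> k. sgn (quot z $ k))"
  have "u \<in> K"
  proof (rule character_duality)
    show "K \<subseteq> unit_torus" by (auto simp: K_def)
    show "1 \<in> K" using T_facts(2) by (auto simp: K_def unit_torus_def intro!: bexI[of _ 1])
    show "x * y \<in> K" if "x \<in> K" "y \<in> K" for x y
    proof -
      obtain s t where "s \<in> T" "\<forall>k. z $ k \<noteq> 0 \<longrightarrow> s $ k = x $ k" "t \<in> T" "\<forall>k. z $ k \<noteq> 0 \<longrightarrow> t $ k = y $ k"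
        using \<open>x \<in> K\<close> \<open>y \<in> K\<close> unfolding K_def by blast
      then show ?thesis
        using that T_facts(3)[of s t] by (auto simp: K_def unit_torus_def norm_mult intro!: bexI[of _ "s * t"])
    qed
    show "(\<chi> k. inverse (x $ k)) \<in> K" if "x \<in> K" for x
    proof -
      obtain s where "s \<in> T" "\<forall>k. z $ k \<noteq> 0 \<longrightarrow> s $ k = x $ k"
        using \<open>x \<in> K\<close> unfolding K_def by blast
      then show ?thesis
        using that T_facts(4)[of s] by (auto simp: K_def unit_torus_def norm_inverse intro!: bexI[of _ "\<chi> k. inverse (s $ k)"])
    qed
    \<comment> \<open>Exhibits \<open>K\<close> as a continuous image of a compact set, which yields
      closedness.\<close>
    have K_image: "K = (\<lambda>(t, w). \<chi> k. if z $ k \<noteq> 0 then t $ k else w $ k) ` (T \<times> unit_torus)" (is "_ = ?f ` _")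
    proof (intro equalityI subsetI)
      fix w assume w: "w \<in> K"
      then obtain t where t: "t \<in> T" "\<forall>k. z $ k \<noteq> 0 \<longrightarrow> t $ k = w $ k" "w \<in> unit_torus"
        unfolding K_def by blast
      then show "w \<in> ?f ` (T \<times> unit_torus)"
        by (intro image_eqI[of _ _ "(t, w)"]) (auto simp: vec_eq_iff)
    next
      fix w assume "w \<in> ?f ` (T \<times> unit_torus)"
      then show "w \<in> K" using T_facts(1) by (auto simp: K_def unit_torus_def)
    qed
    have "continuous_on (T \<times> unit_torus) ?f"
      unfolding case_prod_unfold
    proof (rule continuous_on_vec_lambda)
      show "continuous_on (T \<times> unit_torus) (\<lambda>x. if z $ k \<noteq> 0 then fst x $ k else snd x $ k)" for k
        by (cases "z $ k = 0") (auto intro!: continuous_intros)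
    qed
    then have "compact K"
      unfolding K_image by (rule compact_continuous_image) (intro compact_Times compact_T compact_unit_torus)
    then show "closed K" by (rule compact_imp_closed)
    show "u \<in> unit_torus" using quot_nonzero by (auto simp: u_def unit_torus_def norm_sgn)
    fix m assume triv: "\<And>w. w \<in> K \<Longrightarrow> character m w = 1"
    have m0: "m k = 0" if "z $ k = 0" for k
    proof (rule ccontr)
      assume mk: "m k \<noteq> 0"
      \<comment> \<open>A free phase chosen so that the character takes the value -1; below,
        \<open>?y\<close> does the same inside \<open>T\<close>.\<close>
      have "iexp (axis k (pi / m k)) \<in> K"
        unfolding K_def using T_facts(2) that by (auto simp: unit_torus_def axis_def intro!: bexI[of _ 1])
      then have "cis (inner (ivec m) (axis k (pi / m k))) = 1" using triv character_iexp by metis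
      then show False using mk by (simp add: inner_axis)
    qed
    have mV: "inner (ivec m) x = 0" if "x \<in> V" for x
    proof (rule ccontr)
      assume nz: "inner (ivec m) x \<noteq> 0"
      let ?y = "(pi / inner (ivec m) x) *\<^sub>R x"
      have "iexp ?y \<in> T" using that real_lie_alg_iff by blast
      then have "iexp ?y \<in> K" using T_facts(1) unfolding K_def by blast
      then have "cis (inner (ivec m) ?y) = 1" using triv character_iexp by metis
      then show False using nz by simp
    qed
    have "character m u = (\<Prod>k\<in>UNIV. (quot z $ k / of_real (cmod (quot z $ k))) powi m k)"
      by (simp add: character_def u_def sgn_eq)
    also have "\<dots> = character m (quot z) / of_real (\<Prod>k\<in>UNIV. cmod (quot z $ k) powi m k)"
      by (simp add: character_def power_int_divide_distrib prod_dividef)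
    also have "\<dots> = 1"
      using hull_character_quot[OF z mV m0] hull_norm_character_quot[OF z mV m0] by simp
    finally show "character m u = 1" .
  qed
  then show ?thesis using that by (auto simp: K_def u_def)
qed

text \<open>Otherwise a nonnegative separating normal supported where \<open>z\<close> is nonzero,
  scaled by a large \<open>N\<close> and rounded up, is the exponent of a monomial larger at
  \<open>z\<close> than anywhere on \<open>Y\<close>.\<close>

lemma hull_dominated:
  assumes z: "z \<in> polynomial_hull Y"
    and x: "\<And>k. z $ k \<noteq> 0 \<Longrightarrow> exp (x $ k) = cmod (quot z $ k)"
  obtains q where "q \<in> convex hull F" "\<And>k. z $ k \<noteq> 0 \<Longrightarrow> x $ k \<le> q $ k"
proof -
  let ?S = "{k. z $ k \<noteq> 0}"
  have "\<exists>q\<in>convex hull F. \<forall>k\<in>?S. x $ k \<le> q $ k"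
  proof (rule ccontr)
    assume no: "\<not> ?thesis"
    have "convex hull F \<noteq> {}" using F(2) by simp
    then obtain a b where a: "\<And>k. a $ k \<ge> 0" "\<And>k. z $ k = 0 \<Longrightarrow> a $ k = 0" "inner a x > b"
        and ab: "\<And>q. q \<in> convex hull F \<Longrightarrow> inner a q < b"
      using convex_compact_dominates[OF convex_convex_hull compact_convex_hull[OF finite_imp_compact[OF F(1)]] _ no]
      by auto
    \<comment> \<open>Rounding moves each exponent by at most 1, so \<open>s\<close> bounds its
      total effect for every \<open>y \<in> F\<close>; \<open>N\<close> makes the scaled gap
      \<open>inner a x - b\<close> exceed it.\<close>
    define s where "s = (\<Sum>y\<in>F. \<Sum>k\<in>UNIV. \<bar>x $ k - y $ k\<bar>)"
    obtain N :: nat where N: "real N > s / (inner a x - b)" using reals_Archimedean2 by blast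
    define \<alpha> where "\<alpha> k = nat \<lceil>real N * a $ k\<rceil>" for k
    have \<alpha>: "0 \<le> real (\<alpha> k) - real N * a $ k" "real (\<alpha> k) - real N * a $ k \<le> 1" for k
    proof -
      have "real N * a $ k \<ge> 0" using a(1) by simp
      then have "real (\<alpha> k) = of_int \<lceil>real N * a $ k\<rceil>" by (simp add: \<alpha>_def)
      then show "0 \<le> real (\<alpha> k) - real N * a $ k" "real (\<alpha> k) - real N * a $ k \<le> 1" by linarith+
    qed
    \<comment> \<open>Rounding up leaves the exponent 0 at the zeros of \<open>z\<close>, so the
      monomial does not vanish at \<open>z\<close>.\<close>
    have \<alpha>0: "\<alpha> k = 0" if "z $ k = 0" for k using a(2)[OF that] by (simp add: \<alpha>_def)
    have less: "(\<Sum>k\<in>UNIV. real (\<alpha> k) * y $ k) < (\<Sum>k\<in>UNIV. real (\<alpha> k) * x $ k)" if y: "y \<in> F" for y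
    proof -
      have "(\<Sum>k\<in>UNIV. \<bar>x $ k - y $ k\<bar>) \<le> s"
        unfolding s_def using F(1) y by (intro member_le_sum) (auto intro: sum_nonneg)
      also have "s < real N * (inner a x - b)" using N a(3) by (simp add: field_simps)
      also have "\<dots> \<le> real N * (inner a x - inner a y)"
        using ab[OF hull_inc[OF y]] by (intro mult_left_mono) auto
      also have "\<dots> = (\<Sum>k\<in>UNIV. real N * a $ k * (x $ k - y $ k))"
        by (simp add: inner_vec_real sum_distrib_left sum_subtractf algebra_simps)
      finally have 1: "(\<Sum>k\<in>UNIV. \<bar>x $ k - y $ k\<bar>) < (\<Sum>k\<in>UNIV. real N * a $ k * (x $ k - y $ k))" .
      have "(\<Sum>k\<in>UNIV. - ((real (\<alpha> k) - real N * a $ k) * (x $ k - y $ k))) \<le> (\<Sum>k\<in>UNIV. \<bar>x $ k - y $ k\<bar>)"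
      proof (rule sum_mono)
        fix k
        have "- ((real (\<alpha> k) - real N * a $ k) * (x $ k - y $ k)) \<le> \<bar>(real (\<alpha> k) - real N * a $ k) * (x $ k - y $ k)\<bar>"
          by linarith
        also have "\<dots> \<le> 1 * \<bar>x $ k - y $ k\<bar>"
          unfolding abs_mult using \<alpha>[of k] by (intro mult_right_mono) auto
        finally show "- ((real (\<alpha> k) - real N * a $ k) * (x $ k - y $ k)) \<le> \<bar>x $ k - y $ k\<bar>" by simp
      qed
      with 1 have "0 < (\<Sum>k\<in>UNIV. real N * a $ k * (x $ k - y $ k)) - (\<Sum>k\<in>UNIV. - ((real (\<alpha> k) - real N * a $ k) * (x $ k - y $ k)))"
        by linarith
      also have "\<dots> = (\<Sum>k\<in>UNIV. real (\<alpha> k) * x $ k) - (\<Sum>k\<in>UNIV. real (\<alpha> k) * y $ k)"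
        by (simp add: algebra_simps flip: sum_subtractf)
      finally show ?thesis by simp
    qed
    define B where "B = Max ((\<lambda>y. exp (\<Sum>k\<in>UNIV. real (\<alpha> k) * y $ k)) ` F)"
    have "cmod (\<Prod>k\<in>UNIV. (z $ k / v $ k) ^ \<alpha> k) \<le> B"
    proof (rule polynomial_hullD[OF z polynomial_fun_monomial Y_nonempty])
      fix y assume "y \<in> Y"
      then obtain t w where y: "t \<in> T" "w \<in> F" "y = t * rexp w * v" using Y_iff by blast
      show "cmod (\<Prod>k\<in>UNIV. (y $ k / v $ k) ^ \<alpha> k) \<le> B"
        unfolding monomial_on_Y[OF y(3,1)] B_def using F(1) y(2) by (intro Max_ge) auto
    qed
    also have "B < exp (\<Sum>k\<in>UNIV. real (\<alpha> k) * x $ k)"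
      unfolding B_def using F(1,2) less by (subst Max_less_iff) auto
    also have "\<dots> = (\<Prod>k\<in>UNIV. exp (x $ k) ^ \<alpha> k)" by (simp add: exp_sum exp_of_nat_mult)
    also have "\<dots> = (\<Prod>k\<in>UNIV. cmod (z $ k / v $ k) ^ \<alpha> k)"
    proof (rule prod.cong[OF refl])
      show "exp (x $ k) ^ \<alpha> k = cmod (z $ k / v $ k) ^ \<alpha> k" for k
        using x[of k] \<alpha>0[of k] by (cases "z $ k = 0") (auto simp: quot_def)
    qed
    finally show False by (simp add: prod_norm[symmetric] norm_power)
  qed
  then show ?thesis using that by auto
qed

lemma hull_subset: "polynomial_hull Y \<subseteq> T * rexp ` P * I_set T * {v}"
proof
  fix z assume z: "z \<in> polynomial_hull Y"
  obtain \<xi> where \<xi>: "\<xi> \<in> V" "\<And>k. z $ k \<noteq> 0 \<Longrightarrow> \<xi> $ k = 0" "\<And>k. z $ k = 0 \<Longrightarrow> \<xi> $ k < 0"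
    using hull_zeros_direction[OF z] by blast
  obtain x where x: "x \<in> V" "\<And>k. z $ k \<noteq> 0 \<Longrightarrow> exp (x $ k) = cmod (quot z $ k)"
    using hull_modulus[OF z] by blast
  obtain t where t: "t \<in> T" "\<And>k. z $ k \<noteq> 0 \<Longrightarrow> t $ k = sgn (quot z $ k)"
    using hull_phase[OF z] by blast
  obtain q where q: "q \<in> convex hull F" "\<And>k. z $ k \<noteq> 0 \<Longrightarrow> x $ k \<le> q $ k"
    using hull_dominated[OF z x(2)] by blast
  have "convex hull F \<subseteq> V" by (intro hull_minimal F(3) subspace_imp_convex V)
  then have qV: "q \<in> V" using q(1) by blast
  \<comment> \<open>Large enough for \<open>r *\<^sub>R \<xi>\<close> to outweigh
    \<open>x - q\<close> at every zero of \<open>z\<close>; terms with \<open>\<xi> $ k = 0\<close>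
    are 0 by division by zero. As \<open>\<xi>\<close> vanishes on the support, \<open>q + c\<close>
    agrees with \<open>x\<close> there, while \<open>l\<close> kills the other coordinates.\<close>
  define r where "r = (\<Sum>k\<in>UNIV. \<bar>(x - q) $ k\<bar> / \<bar>\<xi> $ k\<bar>)"
  define c where "c = (x - q) + r *\<^sub>R \<xi>"
  have "c \<in> C_cone T"
    unfolding C_cone_iff
  proof (intro conjI allI)
    show "c \<in> V" unfolding c_def using V x(1) qV \<xi>(1) by (intro subspace_add subspace_diff subspace_scale)
    fix k
    show "c $ k \<le> 0"
    proof (cases "z $ k = 0")
      case True
      have "\<bar>(x - q) $ k\<bar> / \<bar>\<xi> $ k\<bar> \<le> r"
        unfolding r_def by (rule member_le_sum) auto
      then have "\<bar>(x - q) $ k\<bar> \<le> r * \<bar>\<xi> $ k\<bar>" using \<xi>(3)[OF True] by (simp add: field_simps)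
      also have "\<dots> = - (r * \<xi> $ k)" using \<xi>(3)[OF True] by simp
      finally show ?thesis unfolding c_def by simp
    next
      case False
      then show ?thesis using q(2) \<xi>(2) by (simp add: c_def)
    qed
  qed
  then have P: "q + c \<in> P" using q(1) by blast
  define l :: "complex^'n" where "l = (\<chi> k. if z $ k = 0 then 0 else 1)"
  have "((\<lambda>r::real. rexp (r *\<^sub>R \<xi>)) \<longlongrightarrow> l) at_top"
  proof (rule vec_tendstoI)
    fix k
    show "((\<lambda>r::real. rexp (r *\<^sub>R \<xi>) $ k) \<longlongrightarrow> l $ k) at_top"
    proof (cases "z $ k = 0")
      case True
      have "filterlim (\<lambda>r. \<xi> $ k * r) at_bot at_top"
        using \<xi>(3)[OF True] by (rule filterlim_tendsto_neg_mult_at_bot[OF tendsto_const _ filterlim_ident])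
      then have "((\<lambda>r. exp (\<xi> $ k * r)) \<longlongrightarrow> 0) at_top"
        by (rule filterlim_compose[OF exp_at_bot])
      then have "((\<lambda>r. complex_of_real (exp (r * \<xi> $ k))) \<longlongrightarrow> of_real 0) at_top"
        by (intro tendsto_of_real) (simp add: mult.commute)
      then show ?thesis using True by (simp add: l_def)
    next
      case False
      then show ?thesis using \<xi>(2) by (simp add: l_def)
    qed
  qed
  moreover have "\<xi> \<in> C_cone T"
    unfolding C_cone_iff using \<xi> by (metis less_imp_le order_refl)
  ultimately have l: "l \<in> I_set T" unfolding I_set_def by blast
  have "z = t * rexp (q + c) * l * v"
  proof (subst vec_eq_iff, intro allI)
    fix k
    show "z $ k = (t * rexp (q + c) * l * v) $ k"
    proof (cases "z $ k = 0")
      case False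
      have "(q + c) $ k = x $ k" using \<xi>(2)[OF False] by (simp add: c_def)
      then have "(t * rexp (q + c) * l * v) $ k = sgn (quot z $ k) * of_real (cmod (quot z $ k)) * v $ k"
        using False t(2) x(2) by (simp add: l_def)
      also have "\<dots> = quot z $ k * v $ k"
        using quot_nonzero[of z k] by (simp add: sgn_eq)
      also have "\<dots> = z $ k" using False v by (simp add: quot_def)
      finally show ?thesis by simp
    qed (simp add: l_def)
  qed
  then show "z \<in> T * rexp ` P * I_set T * {v}"
    using t(1) P l by (auto intro!: set_times_intro)
qed

text \<open>The three inclusions form a cycle: hull, limit points, closure, hull.\<close>

lemma hull_eq_closure: "polynomial_hull Y = closure (T * rexp ` P * {v})"
  and hull_eq_limits: "polynomial_hull Y = T * rexp ` P * I_set T * {v}"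
  using hull_subset I_set_subset_closure closure_subset_hull by blast+

end

section \<open>Reduction of the theorem to orbits through exponents in \<open>F\<close>\<close>

theorem proposition2p2:
  fixes T :: "(complex^'n) set" and v :: "complex^'n"
    and orbits :: "(complex^'n) set set" and X Y :: "(complex^'n) set"
  assumes "is_torus T" and "simple_spectrum T"
    and "\<forall>k. v $ k \<noteq> 0"
    and "finite orbits"
    and "\<forall>S\<in>orbits. \<exists>u. S = T * {u}"
    and "T * {v} \<in> orbits"
    and "Y = \<Union>orbits"
    and "Y \<subseteq> complex_torus T * {v}"
    and "X = (real_torus T * {v}) \<inter> Y"
  shows "finite X \<and>
    polynomial_hull Y = closure (T * rexp ` P_set T v X * {v}) \<and>
    (\<forall>(N :: (real^'n) set) (c :: real^'n \<Rightarrow> real).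
       finite N \<and> P_set T v X = {x \<in> real_lie_alg T. \<forall>s\<in>N. x \<bullet> s \<le> c s} \<longrightarrow>
       polynomial_hull Y =
         closure {z \<in> complex_torus T * {v}. \<forall>s\<in>N. nu s z \<le> exp (c s) * nu s v}) \<and>
    polynomial_hull Y = (\<Union>u \<in> rexp ` Q_set T v X * {v}. polynomial_hull (T * {u})) \<and>
    polynomial_hull Y = T * rexp ` P_set T v X * I_set T * {v}"
proof -
  let ?V = "real_lie_alg T"
  have V: "subspace ?V" by (rule subspace_real_lie_alg[OF assms(1)])
  have v: "v $ k \<noteq> 0" for k using assms(3) by blast
  have cancel: "a = b" if "a * v = b * v" for a b
    using that v by (simp add: vec_eq_iff)
  have T: "T \<subseteq> unit_torus" "1 \<in> T" "\<And>s t. s \<in> T \<Longrightarrow> t \<in> T \<Longrightarrow> s * t \<in> T"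
    "\<And>t. t \<in> T \<Longrightarrow> (\<chi> k. inverse (t $ k)) \<in> T"
    using assms(1) by (auto simp: is_torus_def)
  have T1: "cmod (t $ k) = 1" if "t \<in> T" for t k using that T(1) by (auto simp: unit_torus_def)
  have complex_torus_iff: "w \<in> complex_torus T \<longleftrightarrow> (\<exists>s\<in>?V. \<exists>x\<in>?V. w = iexp s * rexp x)" for w
  proof -
    have "vexp ((\<chi> k. \<i> * of_real (s $ k)) + cvec x) = iexp s * rexp x" for s x :: "real^'n"
      by (simp add: vec_eq_iff vexp_def cvec_def exp_add exp_of_real cis_conv_exp)
    then have "(\<exists>\<xi>\<in>lie_alg T. \<exists>x\<in>?V. w = vexp (\<xi> + cvec x)) \<longleftrightarrow> (\<exists>s\<in>?V. \<exists>x\<in>?V. w = iexp s * rexp x)"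
      unfolding Bex_def lie_alg_iff real_lie_alg_iff by metis
    then show ?thesis unfolding complex_torus_def by (auto simp: set_plus_def image_iff)
  qed
  \<comment> \<open>Surjectivity of the exponential is read off from
    \<open>T * {v} \<subseteq> complex_torus T * {v}\<close>: in \<open>t = iexp s * rexp x\<close>
    the moduli 1 of \<open>t\<close> force \<open>rexp x = 1\<close>.\<close>
  have T_iexp: "T \<subseteq> iexp ` ?V"
  proof
    fix t assume t: "t \<in> T"
    then have "t * v \<in> complex_torus T * {v}"
      using assms(6,7,8) by (auto simp: set_times_def)
    then obtain w where "w \<in> complex_torus T" "t * v = w * v" by (auto simp: set_times_def)
    then have "t \<in> complex_torus T" using cancel by blast
    then obtain s x where sx: "s \<in> ?V" "t = iexp s * rexp x" using complex_torus_iff by blast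
    have "exp (x $ k) = 1" for k
      using T1[OF t, of k] by (simp add: sx(2) norm_mult)
    then have "rexp x = 1" by (simp add: vec_eq_iff)
    then show "t \<in> iexp ` ?V" using sx by simp
  qed
  have V_T: "iexp s \<in> T" if "s \<in> ?V" for s
    using that unfolding real_lie_alg_iff by (metis scaleR_one)
  have complex_torus_eq: "complex_torus T = T * rexp ` ?V"
    unfolding set_eq_iff complex_torus_iff using T_iexp V_T by (fastforce simp: set_times_def)
  have rexp_inj: "x = y" if "\<And>k. cmod (rexp x $ k * w $ k) = cmod (rexp y $ k * w $ k)" "\<And>k. w $ k \<noteq> 0"
    for x y :: "real^'n" and w :: "complex^'n"
    using that by (simp add: vec_eq_iff norm_mult)
  have log_at: "log_at T v (rexp x * v) = x" if "x \<in> ?V" for x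
    unfolding log_at_def
  proof (rule inv_into_f_eq[OF inj_onI])
    show "a = b" if "rexp a * v = rexp b * v" for a b
      using that v by (intro rexp_inj[of a v b]) (auto simp: vec_eq_iff)
  qed (use that in auto)
  define F where "F = log_at T v ` X"
  have X: "x \<in> X \<longleftrightarrow> (\<exists>a\<in>?V. x = rexp a * v) \<and> x \<in> Y" for x
    using assms(9) by (auto simp: real_torus_def set_times_def)
  have F_iff: "a \<in> F \<longleftrightarrow> a \<in> ?V \<and> rexp a * v \<in> Y" for a
    unfolding F_def using X log_at by (auto simp: image_iff) (metis log_at)
  \<comment> \<open>\<open>T\<close> preserves coordinate moduli and these determine a point of
    \<open>real_torus T * {v}\<close>, so each orbit contributes at most one point.\<close>
  have "finite X"
  proof -
    have "finite (X \<inter> S)" if S: "S \<in> orbits" for S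
    proof -
      obtain u where u: "S = T * {u}" using assms(5) S by blast
      have "x = y" if "x \<in> X \<inter> S" "y \<in> X \<inter> S" for x y
      proof -
        have *: "\<exists>a s. x = rexp a * v \<and> x = s * u \<and> s \<in> T" if "x \<in> X \<inter> S" for x
          using that X[of x] by (auto simp: u set_times_def)
        obtain a b s t where ab: "x = rexp a * v" "y = rexp b * v" "x = s * u" "y = t * u" "s \<in> T" "t \<in> T"
          using *[OF \<open>x \<in> X \<inter> S\<close>] *[OF \<open>y \<in> X \<inter> S\<close>] by blast
        have "cmod (x $ k) = cmod (u $ k)" "cmod (y $ k) = cmod (u $ k)" for k
          using T1[OF ab(5), of k] T1[OF ab(6), of k] by (simp_all add: ab(3,4) norm_mult)
        then have "cmod ((rexp a * v) $ k) = cmod ((rexp b * v) $ k)" for k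
          using ab(1,2) by metis
        then have "a = b" using v by (intro rexp_inj[of a v b]) simp_all
        then show ?thesis by (simp add: ab)
      qed
      then have "\<exists>x. X \<inter> S \<subseteq> {x}" by blast
      then show ?thesis by (meson finite.emptyI finite.insertI finite_subset)
    qed
    then have "finite (\<Union>S\<in>orbits. X \<inter> S)" using assms(4) by blast
    moreover have "X \<subseteq> (\<Union>S\<in>orbits. X \<inter> S)" using assms(7,9) by blast
    ultimately show ?thesis by (rule finite_subset[rotated])
  qed
  have Tv: "T * {v} \<subseteq> Y" using assms(6,7) by blast
  have "1 * v \<in> Y" using Tv T(2) by blast
  then have "0 \<in> F" unfolding F_iff using subspace_0[OF V] by simp
  then have "F \<noteq> {}" by blast
  moreover have "finite F" unfolding F_def using \<open>finite X\<close> by (rule finite_imageI)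
  moreover have "F \<subseteq> ?V" using F_iff by blast
  ultimately interpret torus_orbits T v F
    using assms(1) T_iexp v by unfold_locales
  \<comment> \<open>Each orbit in \<open>Y\<close> passes through some
    \<open>u = t * rexp x * v\<close>; multiplying by the inverse of \<open>t\<close> gives a point
    of \<open>X\<close> on the same orbit, so \<open>x \<in> F\<close>.\<close>
  have Y_eq: "Y = T * rexp ` F * {v}"
  proof (intro equalityI subsetI)
    fix y assume "y \<in> Y"
    then obtain S u where S: "S \<in> orbits" "y \<in> S" "S = T * {u}" using assms(5,7) by blast
    obtain s where s: "s \<in> T" "y = s * u" using S by (auto simp: set_times_def)
    have "1 * u \<in> T * {u}" using T(2) by blast
    then have "u \<in> Y" using S assms(7) by auto
    then obtain t x where t: "t \<in> T" "x \<in> ?V" "u = t * rexp x * v"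
      using assms(8) unfolding complex_torus_eq by (auto simp: set_times_def)
    let ?t' = "\<chi> k. inverse (t $ k)"
    have "?t' * t = 1" using unit_torus_nonzero[of t] T(1) t(1) by (auto simp: vec_eq_iff)
    then have "?t' * u = rexp x * v" by (simp add: t(3) mult.assoc[symmetric])
    moreover have "?t' * u \<in> Y" using T(4)[OF t(1)] S assms(7) by (auto simp: set_times_def)
    ultimately have "x \<in> F" unfolding F_iff using t(2) by simp
    moreover have "y = (s * t) * rexp x * v" by (simp add: s t mult.assoc)
    ultimately show "y \<in> T * rexp ` F * {v}"
      using T(3)[OF s(1) t(1)] by (auto intro!: set_times_intro)
  next
    fix y assume "y \<in> T * rexp ` F * {v}"
    then obtain t x where t: "t \<in> T" "x \<in> F" "y = t * (rexp x * v)"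
      by (auto simp: set_times_def mult.assoc)
    then obtain S u where S: "S \<in> orbits" "rexp x * v \<in> S" "S = T * {u}" using assms(5,7) F_iff by blast
    then obtain s where s: "s \<in> T" "rexp x * v = s * u" by (auto simp: set_times_def)
    have "y = (t * s) * u" by (simp add: t(3) s(2) mult.assoc)
    then have "y \<in> S" using T(3)[OF t(1) s(1)] S(3) by (auto simp: set_times_def)
    then show "y \<in> Y" using S(1) assms(7) by blast
  qed
  have Q: "Q_set T v X = convex hull F" and P: "P_set T v X = convex hull F + C_cone T"
    by (simp_all add: Q_set_def P_set_def F_def)
  have hull_closure: "polynomial_hull Y = closure (T * rexp ` P_set T v X * {v})"
    unfolding P Y_eq by (rule hull_eq_closure)
  \<comment> \<open>\<open>nu s\<close> is \<open>T\<close>-invariant and picks up the factor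
    \<open>exp (x \<bullet> s)\<close> under \<open>rexp x\<close>, so its inequalities are the
    half-spaces cutting out \<open>P_set T v X\<close>.\<close>
  have nu_set: "{z \<in> complex_torus T * {v}. \<forall>s\<in>N. nu s z \<le> exp (c s) * nu s v} = T * rexp ` P_set T v X * {v}"
    if N: "P_set T v X = {x \<in> ?V. \<forall>s\<in>N. x \<bullet> s \<le> c s}" for N c
  proof -
    have nu: "nu s (t * rexp x * v) \<le> exp (c s) * nu s v \<longleftrightarrow> x \<bullet> s \<le> c s" if "t \<in> T" for s t x
    proof -
      have "nu s (t * rexp x * v) = (\<Prod>k\<in>UNIV. exp (x $ k * s $ k) * cmod (v $ k) powr (s $ k))"
        unfolding nu_def using T1[OF that] v
        by (intro prod.cong) (auto simp: norm_mult powr_mult exp_powr_real)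
      also have "\<dots> = exp (x \<bullet> s) * nu s v"
        by (simp add: prod.distrib nu_def inner_vec_real exp_sum)
      finally have "nu s (t * rexp x * v) = exp (x \<bullet> s) * nu s v" .
      moreover have "nu s v > 0" unfolding nu_def by (rule prod_pos) (simp add: v)
      ultimately show ?thesis by simp
    qed
    show ?thesis
    proof (intro equalityI subsetI)
      fix z assume z: "z \<in> {z \<in> complex_torus T * {v}. \<forall>s\<in>N. nu s z \<le> exp (c s) * nu s v}"
      then obtain t x where t: "t \<in> T" "x \<in> ?V" "z = t * rexp x * v"
        unfolding complex_torus_eq by (auto simp: set_times_def)
      then have "x \<in> P_set T v X" using z nu[OF t(1)] unfolding N by auto
      then show "z \<in> T * rexp ` P_set T v X * {v}"
        unfolding t(3) using t(1) by (intro set_times_intro imageI) auto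
    next
      fix z assume "z \<in> T * rexp ` P_set T v X * {v}"
      then obtain t x where t: "t \<in> T" "x \<in> P_set T v X" "z = t * rexp x * v"
        by (auto simp: set_times_def)
      then have "x \<in> ?V" "\<forall>s\<in>N. x \<bullet> s \<le> c s" unfolding N by auto
      moreover from this have "z \<in> complex_torus T * {v}"
        unfolding t(3) complex_torus_eq using t(1) by (intro set_times_intro imageI) auto
      ultimately show "z \<in> {z \<in> complex_torus T * {v}. \<forall>s\<in>N. nu s z \<le> exp (c s) * nu s v}"
        using nu[OF t(1)] by (simp add: t(3))
    qed
  qed
  have hull_nu: "\<forall>(N :: (real^'n) set) (c :: real^'n \<Rightarrow> real).
       finite N \<and> P_set T v X = {x \<in> ?V. \<forall>s\<in>N. x \<bullet> s \<le> c s} \<longrightarrow>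
       polynomial_hull Y = closure {z \<in> complex_torus T * {v}. \<forall>s\<in>N. nu s z \<le> exp (c s) * nu s v}"
  proof (intro allI impI)
    fix N :: "(real^'n) set" and c :: "real^'n \<Rightarrow> real"
    assume "finite N \<and> P_set T v X = {x \<in> ?V. \<forall>s\<in>N. x \<bullet> s \<le> c s}"
    then have "P_set T v X = {x \<in> ?V. \<forall>s\<in>N. x \<bullet> s \<le> c s}" ..
    from nu_set[OF this] show "polynomial_hull Y = closure {z \<in> complex_torus T * {v}. \<forall>s\<in>N. nu s z \<le> exp (c s) * nu s v}"
      unfolding hull_closure by (rule arg_cong[OF sym])
  qed
  have FV: "convex hull F \<subseteq> ?V" by (intro hull_minimal F(3) subspace_imp_convex V)
  have orbit: "T * {rexp q * v} = T * rexp ` {q} * {v}" for q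
    by (auto simp: set_times_def mult.assoc)
  have "polynomial_hull Y = (\<Union>u \<in> rexp ` Q_set T v X * {v}. polynomial_hull (T * {u}))"
  proof (intro equalityI subsetI)
    fix z assume "z \<in> polynomial_hull Y"
    then have "z \<in> T * rexp ` (convex hull F + C_cone T) * I_set T * {v}"
      unfolding Y_eq hull_eq_limits .
    then obtain t q c l where z: "z = t * rexp (q + c) * l * v" "t \<in> T" "q \<in> convex hull F" "c \<in> C_cone T" "l \<in> I_set T"
      by (auto simp: set_times_def set_plus_def)
    \<comment> \<open>The description by limits, used for the single orbit through
      \<open>rexp q * v\<close>, already contains \<open>z\<close>.\<close>
    interpret q: torus_orbits T v "{q}"
      by standard (use assms(1) T_iexp v z(3) FV in auto)
    have "q + c \<in> convex hull {q} + C_cone T"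
      by (rule set_plus_intro[OF _ z(4)]) simp
    then have "z \<in> T * rexp ` (convex hull {q} + C_cone T) * I_set T * {v}"
      unfolding z(1) by (intro set_times_intro imageI z(2,5) singletonI)
    then have "z \<in> polynomial_hull (T * {rexp q * v})"
      unfolding orbit q.hull_eq_limits .
    then show "z \<in> (\<Union>u \<in> rexp ` Q_set T v X * {v}. polynomial_hull (T * {u}))"
      unfolding Q using z(3) by (auto simp: set_times_def)
  next
    fix z assume "z \<in> (\<Union>u \<in> rexp ` Q_set T v X * {v}. polynomial_hull (T * {u}))"
    then obtain q where q: "q \<in> convex hull F" "z \<in> polynomial_hull (T * {rexp q * v})"
      unfolding Q by (auto simp: set_times_def)
    have "0 \<in> C_cone T" using subspace_0[OF V] by (simp add: C_cone_iff)
    then have qP: "q \<in> convex hull F + C_cone T" using set_plus_intro[OF q(1)] by fastforce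
    \<comment> \<open>Since \<open>q\<close> lies in \<open>P\<close>, a bound for \<open>p\<close>
      on \<open>Y\<close> holds on the orbit of \<open>rexp q * v\<close>, hence on its
      hull.\<close>
    show "z \<in> polynomial_hull Y"
      unfolding Y_eq
    proof (rule polynomial_hullI[OF compact_Y])
      fix p B assume p: "polynomial_fun p" "\<And>y. y \<in> T * rexp ` F * {v} \<Longrightarrow> cmod (p y) \<le> B"
      show "cmod (p z) \<le> B"
      proof (rule polynomial_hullD[OF q(2) p(1)])
        show "T * {rexp q * v} \<noteq> {}" using T(2) by (auto simp: set_times_def)
        fix y assume "y \<in> T * {rexp q * v}"
        then obtain t where t: "t \<in> T" "y = t * rexp q * v" by (auto simp: set_times_def mult.assoc)
        show "cmod (p y) \<le> B"
          unfolding t(2)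
          by (rule polynomial_fun_bound_convex_hull_plus_cone[OF assms(1) F(3) p(1) _ t(1) qP])
             (intro p(2) set_times_intro imageI singletonI)
      qed
    qed
  qed
  moreover have "polynomial_hull Y = T * rexp ` P_set T v X * I_set T * {v}"
    unfolding P Y_eq by (rule hull_eq_limits)
  ultimately show ?thesis
    by (intro conjI \<open>finite X\<close> hull_closure hull_nu)
qed

end
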